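(* Let $\ell:\mathbb{R}\times\mathcal{G}\times\mathcal{Z}\to\mathbb{R}$ be a universally orthogonal loss with true nuisance $g_0$, and suppose there is a function $\chi:\mathcal{G}\times\mathcal{Z}\to\mathbb{R}$ such that $\mathbb{E}[\partial\ell(\theta,g;Z)\mid X]=\theta(X)-\mathbb{E}[\chi(g;Z)\mid X]$ for any $g\in\mathcal{G}$ and $\theta:\mathcal{X}\to\mathbb{R}$. Suppose $D_g^2\mathbb{E}[\partial\ell(\theta,f;Z)\mid X](g-g_0,g-g_0)$ exists for any $f,g\in\mathcal{G}$. Let $\mathcal{A}_1:\mathcal{Z}^*\to\mathcal{G}$ be a nuisance estimation algorithm and $\mathcal{A}_2:\Theta\times(\mathcal{X}\times\mathbb{R})^*\to\Theta$ a calibration algorithm, where $\Theta\subset\{f:\mathcal{X}\to\mathbb{R}\}$, such that for some rate functions $\mathrm{rate}_1,\mathrm{rate}_2$: 1. For any distribution $P_Z$ on $\mathcal{Z}$, $Z_1,\dots,Z_n\sim P_Z$ i.i.d., and $\delta_1\in(0,1)$, with probability at least $1-\delta_1$, $\mathrm{err}(\widehat g,g_0;\theta)\le\mathrm{rate}_1(n,\delta_1;P_Z)$, where $\widehat g=\mathcal{A}_1(Z_{1:n})$. 2. For any distribution $Q$ on $\mathcal{X}\times\mathbb{R}$, $(X_1,Y_1),\dots,(X_n,Y_n)\sim Q$ i.i.d., initial estimator $\theta:\mathcal{X}\to\mathbb{R}$, and $\delta_2\in(0,1)$, with probability at least $1-\delta_2$, $\mathrm{Cal}(\widehat\theta;Q)\le\mathrm{rate}_2(n,\delta_2;Q)$,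 where $\widehat\theta=\mathcal{A}_2(\theta,\{(X_i,Y_i)\}_{i=1}^n)$. Let $\theta$ be an initial estimator and let $Z_1,\dots,Z_{2n}\sim P_Z$ be i.i.d. Set $\widehat g=\mathcal{A}_1(Z_{1:n})$, $\chi_m=\chi(\widehat g;Z_m)$ for $n+1\le m\le 2n$, and $\widehat\theta=\mathcal{A}_2(\theta,(X_m,\chi_m)_{m=n+1}^{2n})$. Then, with probability at least $1-\delta_1-\delta_2$, $$\mathrm{Cal}(\widehat\theta,g_0)\le\tfrac12\,\mathrm{rate}_1(n,\delta_1;P_Z)+\mathrm{rate}_2(n,\delta_2;P^\chi_{\widehat g}),$$ where $P^\chi_{\widehat g}$ denotes the (random) distribution of $(X,\chi(\widehat g;Z))$ for $Z\sim P_Z$ (an independent draw, with $\widehat g$ held fixed).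
   Context: Setting: $Z$ is a random element of a space $\mathcal{Z}$ with distribution $P_Z$; $X$ (covariates, in $\mathcal{X}$) and $W$ (extended variables, in $\mathcal{W}$) are sub-vectors of $Z$, with $X$ a sub-vector of $W$, and $P_X,P_W$ are their marginal laws; $X_m$ is the covariate part of $Z_m$. $\mathcal{G}\subset L^2(\mathcal{W},P_W)$ is a space of nuisance functions $g:\mathcal{W}\to\mathbb{R}^d$; the loss has a true nuisance $g_0\in\mathcal{G}$ (determined by the data distribution). $S^*$ denotes the set of finite sequences in $S$. Notation: $\ell(\theta,g;z)$ abbreviates $\ell(\theta(x),g;z)$, and $\partial\ell(\theta,g;z):=\frac{\partial}{\partial\nu}\ell(\nu,g;z)\big|_{\nu=\theta(x)}$. $D_gT(f)(h)$, $D_g^2T(f)(h,h)$ are the first and second Gateaux derivatives at $f$ in direction $h$ (first and second derivatives in $t$ of $T(f+th)$ at $t=0$). For $f,h\in\mathcal{G}$, $[f,h]:=\{w\mapsto\lambda(w)f(w)+(1-\lambda(w))h(w):\lambda(w)\in[0,1]\}$, and $$\mathrm{err}(g,h;\theta):=\sup_{f\in[g,h]}\sqrt{\mathbb{E}\Big(\big\{D_g^2\,\mathbb{E}[\partial\ell(\theta,f;Z)\mid X](h-g,h-g)\big\}^2\Big)}.$$ Universal orthogonality: for any $\theta:\mathcal{X}\to\mathbb{R}$ and $g\in\mathcal{G}$, $D_g\,\mathbb{E}[\partial\ell(\theta,g_0;Z)\mid X](g-g_0)=0$. Causal $L^2$ calibration error: $\mathrm{Cal}(\theta,g):=\mathbb{E}\big(\mathbb{E}[\partial\ell(\theta,g;Z)\mid\theta(X)]^2\big)^{1/2}$.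 Classical $L^2$ calibration error, for $(X,Y)\sim Q$ on $\mathcal{X}\times\mathbb{R}$: $\mathrm{Cal}(\theta;Q):=\big(\int_{\mathcal{X}}(\theta(x)-\mathbb{E}_Q[Y\mid\theta(X)=\theta(x)])^2Q_X(dx)\big)^{1/2}$. When evaluated at random (data-dependent) $\widehat\theta,\widehat g$, these functionals are computed with $\widehat\theta,\widehat g$ held fixed and expectation over an independent draw.
   Formalization: It is additionally assumed that the event Cal(θ̂; P^χ_ĝ) ≤ rate_2(n,δ_2; P^χ_ĝ) is measurable in Z_1,…,Z_2n, and that the second Gateaux derivatives exist for all f,g outside one common null set of x; without these the claim can fail. *)

theory Defs
  imports "HOL-Probability.Probability"
begin

definition sigma_rv :: "'a measure \<Rightarrow> ('a \<Rightarrow> 'b) \<Rightarrow> 'b measure \<Rightarrow> 'a measure" where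
  "sigma_rv P U N = vimage_algebra (space P) U N"

text \<open>Square root on [0, infinity], so that errors that are not square integrable get the value
  infinity rather than a default value.\<close>

definition ennsqrt :: "ennreal \<Rightarrow> ennreal" where
  "ennsqrt a = (if a = \<infinity> then \<infinity> else ennreal (sqrt (enn2real a)))"

text \<open>``With probability at least p'' for a property that is not known to be measurable:
  some event of probability at least p is contained in it.\<close>

definition with_prob_ge :: "'a measure \<Rightarrow> real \<Rightarrow> ('a \<Rightarrow> bool) \<Rightarrow> bool" where
  "with_prob_ge M p \<phi> \<longleftrightarrow> (\<exists>E\<in>sets M. (\<forall>\<omega>\<in>E. \<phi> \<omega>) \<and> p \<le> measure M E)"

definition dloss ::
  "(real \<Rightarrow> 'g \<Rightarrow> 'z \<Rightarrow> real) \<Rightarrow> ('z \<Rightarrow> 'x) \<Rightarrow> ('x \<Rightarrow> real) \<Rightarrow> 'g \<Rightarrow> 'z \<Rightarrow> real" where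
  "dloss l X \<theta> g z = deriv (\<lambda>\<nu>. l \<nu> g z) (\<theta> (X z))"

text \<open>The function m is a version of the map from x to E[\<open>\<phi>(Z) | X = x\<close>].\<close>

definition cond_exp_version ::
  "'z measure \<Rightarrow> ('z \<Rightarrow> 'x) \<Rightarrow> 'x measure \<Rightarrow> ('z \<Rightarrow> real) \<Rightarrow> ('x \<Rightarrow> real) \<Rightarrow> bool" where
  "cond_exp_version P X MX \<phi> m \<longleftrightarrow>
     m \<in> borel_measurable MX \<and>
     (AE z in P. real_cond_exp P (sigma_rv P X MX) \<phi> z = m (X z))"

definition square_integrable_functions :: "'w measure \<Rightarrow> ('w \<Rightarrow> real ^ 'd) set" where
  "square_integrable_functions PW =
     {g. g \<in> borel_measurable PW \<and> integrable PW (\<lambda>w. (norm (g w))\<^sup>2)}"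

definition shift :: "('w \<Rightarrow> real ^ 'd) \<Rightarrow> ('w \<Rightarrow> real ^ 'd) \<Rightarrow> real \<Rightarrow> 'w \<Rightarrow> real ^ 'd" where
  "shift f h t = (\<lambda>w. f w + t *\<^sub>R h w)"

text \<open>First and second Gateaux derivatives. The functional T lives on G only, so the corresponding
  existence predicates include that \<open>f + t h\<close> stays in G for all t near 0.\<close>

definition gateaux1 ::
  "(('w \<Rightarrow> real ^ 'd) \<Rightarrow> real) \<Rightarrow> ('w \<Rightarrow> real ^ 'd) \<Rightarrow> ('w \<Rightarrow> real ^ 'd) \<Rightarrow> real" where
  "gateaux1 T f h = deriv (\<lambda>t. T (shift f h t)) 0"

definition gateaux2 ::
  "(('w \<Rightarrow> real ^ 'd) \<Rightarrow> real) \<Rightarrow> ('w \<Rightarrow> real ^ 'd) \<Rightarrow> ('w \<Rightarrow> real ^ 'd) \<Rightarrow> real" where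
  "gateaux2 T f h = deriv (deriv (\<lambda>t. T (shift f h t))) 0"

definition gateaux1_exists ::
  "('w \<Rightarrow> real ^ 'd) set \<Rightarrow> (('w \<Rightarrow> real ^ 'd) \<Rightarrow> real) \<Rightarrow>
   ('w \<Rightarrow> real ^ 'd) \<Rightarrow> ('w \<Rightarrow> real ^ 'd) \<Rightarrow> bool" where
  "gateaux1_exists G T f h \<longleftrightarrow>
     (\<forall>\<^sub>F t in nhds 0. shift f h t \<in> G) \<and>
     (\<lambda>t. T (shift f h t)) differentiable (at 0)"

definition gateaux2_exists ::
  "('w \<Rightarrow> real ^ 'd) set \<Rightarrow> (('w \<Rightarrow> real ^ 'd) \<Rightarrow> real) \<Rightarrow>
   ('w \<Rightarrow> real ^ 'd) \<Rightarrow> ('w \<Rightarrow> real ^ 'd) \<Rightarrow> bool" where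
  "gateaux2_exists G T f h \<longleftrightarrow>
     (\<forall>\<^sub>F t in nhds 0. shift f h t \<in> G) \<and>
     (\<forall>\<^sub>F t in nhds 0. (\<lambda>s. T (shift f h s)) differentiable (at t)) \<and>
     deriv (\<lambda>t. T (shift f h t)) differentiable (at 0)"

definition nuisance_segment ::
  "'w measure \<Rightarrow> ('w \<Rightarrow> real ^ 'd) \<Rightarrow> ('w \<Rightarrow> real ^ 'd) \<Rightarrow> ('w \<Rightarrow> real ^ 'd) set" where
  "nuisance_segment MW f h =
     {(\<lambda>w. c w *\<^sub>R f w + (1 - c w) *\<^sub>R h w) | c.
        c \<in> borel_measurable MW \<and> (\<forall>w. c w \<in> {0..1})}"

text \<open>In the next definition, \<open>T f x\<close> stands for E[\<open>\<partial>l(\<theta>,f;Z) | X = x\<close>], and PX for the law of X.\<close>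

definition nuisance_err ::
  "'x measure \<Rightarrow> 'w measure \<Rightarrow> (('w \<Rightarrow> real ^ 'd) \<Rightarrow> 'x \<Rightarrow> real) \<Rightarrow>
   ('w \<Rightarrow> real ^ 'd) \<Rightarrow> ('w \<Rightarrow> real ^ 'd) \<Rightarrow> ennreal" where
  "nuisance_err PX MW T g h =
     (SUP f \<in> nuisance_segment MW g h.
        ennsqrt (\<integral>\<^sup>+ x. ennreal ((gateaux2 (\<lambda>u. T u x) f (\<lambda>w. h w - g w))\<^sup>2) \<partial>PX))"

text \<open>Universal orthogonality at \<open>g\<^sub>0\<close>, where \<open>ce \<theta> f x\<close> stands for
  E[\<open>\<partial>l(\<theta>,f;Z) | X = x\<close>].\<close>

definition universally_orthogonal ::
  "'x measure \<Rightarrow> ('w \<Rightarrow> real ^ 'd) set \<Rightarrow>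
   (('x \<Rightarrow> real) \<Rightarrow> ('w \<Rightarrow> real ^ 'd) \<Rightarrow> 'x \<Rightarrow> real) \<Rightarrow> ('w \<Rightarrow> real ^ 'd) \<Rightarrow> bool" where
  "universally_orthogonal PX G ce g0 \<longleftrightarrow>
     (\<forall>\<theta> \<in> borel_measurable PX. \<forall>g\<in>G. AE x in PX.
        gateaux1_exists G (\<lambda>f. ce \<theta> f x) g0 (\<lambda>w. g w - g0 w) \<and>
        gateaux1 (\<lambda>f. ce \<theta> f x) g0 (\<lambda>w. g w - g0 w) = 0)"

definition causal_cal ::
  "'z measure \<Rightarrow> (real \<Rightarrow> 'g \<Rightarrow> 'z \<Rightarrow> real) \<Rightarrow> ('z \<Rightarrow> 'x) \<Rightarrow> ('x \<Rightarrow> real) \<Rightarrow> 'g \<Rightarrow> ennreal" where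
  "causal_cal P l X \<theta> g =
     ennsqrt (\<integral>\<^sup>+ z. ennreal
       ((real_cond_exp P (sigma_rv P (\<lambda>z. \<theta> (X z)) borel) (dloss l X \<theta> g) z)\<^sup>2) \<partial>P)"

text \<open>The integrand depends on the pair only through its first component, so the integral over Q
  is the integral over the first marginal of Q.\<close>

definition classical_cal :: "('x \<Rightarrow> real) \<Rightarrow> ('x \<times> real) measure \<Rightarrow> ennreal" where
  "classical_cal \<theta> Q =
     ennsqrt (\<integral>\<^sup>+ p. ennreal
       ((\<theta> (fst p) - real_cond_exp Q (sigma_rv Q (\<lambda>p. \<theta> (fst p)) borel) snd p)\<^sup>2) \<partial>Q)"

definition pseudo_outcome_law ::
  "'z measure \<Rightarrow> 'x measure \<Rightarrow> ('z \<Rightarrow> 'x) \<Rightarrow> ('g \<Rightarrow> 'z \<Rightarrow> real) \<Rightarrow> 'g \<Rightarrow> ('x \<times> real) measure" where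
  "pseudo_outcome_law P MX X chi g = distr P (MX \<Otimes>\<^sub>M borel) (\<lambda>z. (X z, chi g z))"

text \<open>The two stages of the sample splitting algorithm, on a sample \<open>z 1, ..., z (2 n)\<close>.\<close>

definition first_stage :: "('z list \<Rightarrow> 'g) \<Rightarrow> nat \<Rightarrow> (nat \<Rightarrow> 'z) \<Rightarrow> 'g" where
  "first_stage A1 n z = A1 (map z [1..<n + 1])"

definition second_stage ::
  "('z list \<Rightarrow> 'g) \<Rightarrow> (('x \<Rightarrow> real) \<Rightarrow> ('x \<times> real) list \<Rightarrow> 'x \<Rightarrow> real) \<Rightarrow> ('z \<Rightarrow> 'x) \<Rightarrow>
   ('g \<Rightarrow> 'z \<Rightarrow> real) \<Rightarrow> ('x \<Rightarrow> real) \<Rightarrow> nat \<Rightarrow> (nat \<Rightarrow> 'z) \<Rightarrow> 'x \<Rightarrow> real" where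
  "second_stage A1 A2 X chi \<theta> n z =
     A2 \<theta> (map (\<lambda>m. (X (z m), chi (first_stage A1 n z) (z m))) [n + 1..<2 * n + 1])"

end

theory Submission
  imports Defs
begin

text \<open>Conditioning on \<open>\<theta>(X)\<close> gives \<open>E[\<partial>l(\<theta>,g\<^sub>0) | \<theta>(X)] = \<theta>(X) - E[\<chi>(g\<^sub>0) | \<theta>(X)]\<close>. Replacing \<open>g\<^sub>0\<close> by \<open>g\<close>
  turns the right-hand side into the classical calibration error for the pseudo-outcomes \<open>\<chi>(g)\<close>, at an \<open>L\<^sup>2\<close> cost of
  at most the norm of \<open>E[\<partial>l(\<theta>,g) | X] - E[\<partial>l(\<theta>,g\<^sub>0) | X]\<close>. This difference does not depend on \<open>\<theta>\<close>, so the
  nuisance error may be evaluated at the initial estimator instead of the data-dependent one. By orthogonality its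
  Taylor expansion along the line from \<open>g\<^sub>0\<close> to \<open>g\<close> has no first-order term. The integral form of the remainder, the
  Cauchy-Schwarz inequality and Tonelli's theorem bound its norm by half the supremum of the norms of the second
  derivatives along that line; unlike a pointwise mean value argument, this needs no locality of the loss in
  the nuisance. Finally the two samples are independent, and a union bound combines the guarantees.\<close>

section \<open>Second-order Taylor remainder in mean square\<close>

text \<open>Since \<open>\<phi>' 0 = 0\<close>, the increment is the integral of
  \<open>(1 - t) * \<phi>'' t\<close>, and the weight \<open>1 - t\<close> has mass 1/2 on the unit
  interval; Cauchy-Schwarz then gives the factor 2. The Borel function \<open>f\<close> stands in
  for \<open>\<phi>''\<close>, so that a jointly measurable version can be inserted later. No
  continuity of \<open>\<phi>''\<close> is assumed.\<close>

lemma taylor_remainder_sq_le: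
  fixes \<phi> \<phi>' \<phi>'' f :: "real \<Rightarrow> real"
  assumes 1: "\<And>t. t \<in> {0..1} \<Longrightarrow> (\<phi> has_real_derivative \<phi>' t) (at t)"
    and 2: "\<And>t. t \<in> {0..1} \<Longrightarrow> (\<phi>' has_real_derivative \<phi>'' t) (at t)"
    and 0: "\<phi>' 0 = 0"
    and f[measurable]: "f \<in> borel_measurable borel"
    and eq: "\<And>t. t \<in> {0<..<1} \<Longrightarrow> f t = \<phi>'' t"
  shows "ennreal (2 * (\<phi> 1 - \<phi> 0)\<^sup>2) \<le> (\<integral>\<^sup>+t. ennreal (indicator {0..1} t * ((1 - t) * (f t)\<^sup>2)) \<partial>lborel)"
    (is "_ \<le> ?N")
proof (cases "?N = \<infinity>")
  case False
  then obtain r where r: "0 \<le> r" "?N = ennreal r"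
    by (cases ?N) auto
  define I where "I = \<phi> 1 - \<phi> 0"
  \<comment> \<open>The antiderivative is \<open>(1 - t) * \<phi>' t + \<phi> t\<close>. For the
    gauge integral the fundamental theorem applies to any derivative, so integrability of
    \<open>\<phi>''\<close> comes for free.\<close>
  have "((\<lambda>t. (1 - t) * \<phi>'' t) has_integral ((1 - 1) * \<phi>' 1 + \<phi> 1) - ((1 - 0) * \<phi>' 0 + \<phi> 0)) {0..1}"
  proof (rule fundamental_theorem_of_calculus)
    fix t :: real assume t: "t \<in> {0..1}"
    have "((\<lambda>t. (1 - t) * \<phi>' t + \<phi> t) has_real_derivative (1 - t) * \<phi>'' t) (at t)"
      by (auto intro!: derivative_eq_intros 1[OF t] 2[OF t])
    then show "((\<lambda>t. (1 - t) * \<phi>' t + \<phi> t) has_vector_derivative (1 - t) * \<phi>'' t) (at t within {0..1})"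
      using has_real_derivative_iff_has_vector_derivative has_vector_derivative_at_within by blast
  qed simp
  then have "((\<lambda>t. (1 - t) * \<phi>'' t) has_integral I) {0..1}"
    by (simp add: 0 I_def)
  then have I: "((\<lambda>t. (1 - t) * f t) has_integral I) {0..1}"
    by (rule has_integral_spike_finite[rotated 2, of _ _ _ "{0, 1}"]) (auto simp: eq)
  have "((\<lambda>t. 1 - t) has_integral (1 - 1\<^sup>2 / 2) - (0 - 0\<^sup>2 / 2 :: real)) {0..1}"
    by (rule fundamental_theorem_of_calculus)
      (auto intro!: derivative_eq_intros simp: has_real_derivative_iff_has_vector_derivative[symmetric])
  then have J: "((\<lambda>t. 1 - t) has_integral 1 / 2) {0..1::real}"
    by simp
  \<comment> \<open>Cauchy-Schwarz by hand: \<open>2 * I\<close> is the mean of \<open>f\<close>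
    under the normalised weight, and expanding \<open>(1 - t) * (f t - 2 * I)\<^sup>2\<close> bounds
    this integrand by \<open>(1 - t) * (f t)\<^sup>2\<close>. Only functions already known to be
    integrable occur.\<close>
  have "((\<lambda>t. 4 * I * ((1 - t) * f t) - 4 * I\<^sup>2 * (1 - t)) has_integral 4 * I * I - 4 * I\<^sup>2 * (1 / 2)) {0..1}"
    by (intro has_integral_diff has_integral_mult_right I J)
  then have K: "((\<lambda>t. 4 * I * ((1 - t) * f t) - 4 * I\<^sup>2 * (1 - t)) has_integral 2 * I\<^sup>2) {0..1}"
    by (simp add: power2_eq_square)
  have "((\<lambda>t. indicator {0..1} t * ((1 - t) * (f t)\<^sup>2)) has_integral r) UNIV"
  proof (rule nn_integral_has_integral)
    show "0 \<le> indicator {0..1} t * ((1 - t) * (f t)\<^sup>2)" for t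
      by (simp split: split_indicator)
    show "(\<lambda>t. indicator {0..1} t * ((1 - t) * (f t)\<^sup>2)) \<in> borel_measurable borel"
      by measurable
  qed (use r in auto)
  moreover have "(\<lambda>t. indicator {0..1} t * ((1 - t) * (f t)\<^sup>2)) = (\<lambda>t. if t \<in> {0..1} then (1 - t) * (f t)\<^sup>2 else 0)"
    by auto
  ultimately have L: "((\<lambda>t. (1 - t) * (f t)\<^sup>2) has_integral r) {0..1}"
    by (simp only: has_integral_restrict_UNIV)
  have "2 * I\<^sup>2 \<le> r"
  proof (rule has_integral_le[OF K L])
    fix t :: real assume "t \<in> {0..1}"
    then have "0 \<le> (1 - t) * (f t - 2 * I)\<^sup>2"
      by simp
    then show "4 * I * ((1 - t) * f t) - 4 * I\<^sup>2 * (1 - t) \<le> (1 - t) * (f t)\<^sup>2"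
      by (simp add: power2_eq_square algebra_simps)
  qed
  then show ?thesis
    by (simp add: r I_def ennreal_leI)
qed simp

text \<open>Rounding the first argument down to a grid of mesh \<open>1 / Suc i\<close> leaves
  countably many measurable slices; continuity in that argument makes the rounded functions converge
  pointwise.\<close>

lemma borel_measurable_pair_of_continuous:
  fixes f :: "real \<Rightarrow> 'a \<Rightarrow> real"
  assumes meas[measurable]: "\<And>t. f t \<in> borel_measurable M"
    and cont: "\<And>x. x \<in> space M \<Longrightarrow> continuous_on UNIV (\<lambda>t. f t x)"
  shows "(\<lambda>p. f (fst p) (snd p)) \<in> borel_measurable (borel \<Otimes>\<^sub>M M)"
proof (rule borel_measurable_LIMSEQ_real)
  let ?q = "\<lambda>i t. real_of_int \<lfloor>real (Suc i) * t\<rfloor> / real (Suc i)"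
  show "(\<lambda>p. f (?q i (fst p)) (snd p)) \<in> borel_measurable (borel \<Otimes>\<^sub>M M)" for i
    by (rule measurable_compose_countable[where f = "\<lambda>k p. f (real_of_int k / real (Suc i)) (snd p)"]) measurable
  fix p :: "real \<times> 'a" assume "p \<in> space (borel \<Otimes>\<^sub>M M)"
  then have "snd p \<in> space M"
    by (auto simp: space_pair_measure)
  have "(\<lambda>i. ?q i (fst p)) \<longlonglongrightarrow> fst p"
  proof (rule real_tendsto_sandwich)
    show "\<forall>\<^sub>F i in sequentially. fst p - 1 / real (Suc i) \<le> ?q i (fst p)"
    proof (rule always_eventually, rule allI)
      fix i
      have "real (Suc i) * fst p - 1 \<le> real_of_int \<lfloor>real (Suc i) * fst p\<rfloor>"
        by linarith
      then show "fst p - 1 / real (Suc i) \<le> ?q i (fst p)"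
        by (subst pos_le_divide_eq) (simp_all add: right_diff_distrib mult.commute del: of_nat_Suc)
    qed
    show "\<forall>\<^sub>F i in sequentially. ?q i (fst p) \<le> fst p"
      by (rule always_eventually) (simp add: pos_divide_le_eq mult.commute del: of_nat_Suc)
    have "(\<lambda>i. fst p - 1 / real (Suc i)) \<longlonglongrightarrow> fst p - 0"
      by (intro tendsto_intros LIMSEQ_Suc[OF lim_1_over_n])
    then show "(\<lambda>i. fst p - 1 / real (Suc i)) \<longlonglongrightarrow> fst p" by simp
  qed simp
  then show "(\<lambda>i. f (?q i (fst p)) (snd p)) \<longlonglongrightarrow> f (fst p) (snd p)"
    using cont[OF \<open>snd p \<in> space M\<close>] by (auto simp: continuous_on_eq_continuous_at isCont_def intro: isCont_tendsto_compose)
qed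

text \<open>One factor 1/2 comes from Cauchy-Schwarz with weight \<open>1 - t\<close>, the other from integrating that weight over t.\<close>

lemma nn_integral_taylor_remainder_sq_le:
  fixes \<phi> \<phi>' \<phi>'' :: "real \<Rightarrow> 'a \<Rightarrow> real"
  assumes "sigma_finite_measure M"
    and meas: "\<And>t. t \<in> {0..1} \<Longrightarrow> \<phi> t \<in> borel_measurable M"
    and 1: "AE x in M. \<forall>t\<in>{0..1}. ((\<lambda>s. \<phi> s x) has_real_derivative \<phi>' t x) (at t)"
    and 2: "AE x in M. \<forall>t\<in>{0..1}. ((\<lambda>s. \<phi>' s x) has_real_derivative \<phi>'' t x) (at t)"
    and 0: "AE x in M. \<phi>' 0 x = 0"
    and K: "\<And>t. t \<in> {0..1} \<Longrightarrow> (\<integral>\<^sup>+x. ennreal ((\<phi>'' t x)\<^sup>2) \<partial>M) \<le> K"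
  shows "(\<integral>\<^sup>+x. ennreal ((\<phi> 1 x - \<phi> 0 x)\<^sup>2) \<partial>M) \<le> K / 4"
proof -
  interpret sigma_finite_measure M by fact
  interpret pair_sigma_finite lborel M by standard
  have [measurable]: "\<phi> 0 \<in> borel_measurable M" "\<phi> 1 \<in> borel_measurable M"
    by (auto intro: meas)
  from AE_conjI[OF 1 AE_conjI[OF 2 0]] obtain N where N: "N \<in> null_sets M"
    and good: "\<And>x. x \<in> space M - N \<Longrightarrow>
      (\<forall>t\<in>{0..1}. ((\<lambda>s. \<phi> s x) has_real_derivative \<phi>' t x) (at t)) \<and>
      (\<forall>t\<in>{0..1}. ((\<lambda>s. \<phi>' s x) has_real_derivative \<phi>'' t x) (at t)) \<and> \<phi>' 0 x = 0"
    unfolding eventually_ae_filter by blast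
  have N[measurable]: "N \<in> sets M" and AE_N: "AE x in M. x \<notin> N"
    using N by (auto intro: AE_not_in)
  \<comment> \<open>Regularity is known only for times in the unit interval. Clamping extends each
    path continuously to the whole line.\<close>
  define cl :: "real \<Rightarrow> real" where "cl t = max 0 (min 1 t)" for t
  have cl: "cl t \<in> {0..1}" "t \<in> {0..1} \<Longrightarrow> cl t = t" for t
    by (auto simp: cl_def)
  \<comment> \<open>Nothing is assumed about measurability of \<open>\<phi>'\<close> and
    \<open>\<phi>''\<close>. \<open>F1\<close> and \<open>F2\<close> are limits of difference
    quotients of the jointly measurable \<open>F0\<close>, hence jointly measurable whatever
    \<open>lim\<close> returns where there is no limit. Off \<open>N\<close> they agree with
    \<open>\<phi>'\<close> and \<open>\<phi>''\<close> at interior times.\<close>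
  define F0 where "F0 p = (if snd p \<in> N then 0 else \<phi> (cl (fst p)) (snd p))" for p
  define F1 where "F1 p = lim (\<lambda>i. (F0 (fst p + inverse (real (Suc i)), snd p) - F0 p) * real (Suc i))" for p
  define F2 where "F2 p = lim (\<lambda>i. (F1 (fst p + inverse (real (Suc i)), snd p) - F1 p) * real (Suc i))" for p
  have "(\<lambda>p. (\<lambda>t x. if x \<in> N then 0 else \<phi> (cl t) x) (fst p) (snd p)) \<in> borel_measurable (borel \<Otimes>\<^sub>M M)"
  proof (rule borel_measurable_pair_of_continuous)
    show "(\<lambda>x. if x \<in> N then 0 else \<phi> (cl t) x) \<in> borel_measurable M" for t
      using meas[OF cl(1), of t] by measurable
    fix x assume x: "x \<in> space M"
    have "continuous_on UNIV (\<lambda>t. \<phi> (cl t) x)" if "x \<notin> N"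
    proof (rule continuous_on_compose2[of "{0..1}" "\<lambda>s. \<phi> s x"])
      show "continuous_on {0..1} (\<lambda>s. \<phi> s x)"
        using good[of x] x that by (intro continuous_at_imp_continuous_on) (auto intro: DERIV_isCont)
      show "continuous_on UNIV cl"
        unfolding cl_def by (intro continuous_intros)
    qed (use cl in auto)
    then show "continuous_on UNIV (\<lambda>t. if x \<in> N then 0 else \<phi> (cl t) x)"
      by (cases "x \<in> N") auto
  qed
  then have F0_meas[measurable]: "F0 \<in> borel_measurable (borel \<Otimes>\<^sub>M M)"
    unfolding F0_def[abs_def] by simp
  have F1_meas[measurable]: "F1 \<in> borel_measurable (borel \<Otimes>\<^sub>M M)"
    unfolding F1_def[abs_def] by measurable
  have F2_meas[measurable]: "F2 \<in> borel_measurable (borel \<Otimes>\<^sub>M M)"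
    unfolding F2_def[abs_def] by measurable
  have quotient: "(\<lambda>i. (h (t + inverse (real (Suc i))) - h t) * real (Suc i)) \<longlonglongrightarrow> D"
    if "(g has_real_derivative D) (at t)" "\<And>s. s \<in> {0<..<1} \<Longrightarrow> h s = g s" "t \<in> {0<..<1}"
    for h g :: "real \<Rightarrow> real" and t D
  proof -
    have e: "\<forall>\<^sub>F s in nhds t. h s = g s"
      using that(2,3) by (intro eventually_mono[OF eventually_nhds_in_open[of "{0<..<1}" t]]) auto
    then have "(h has_real_derivative D) (at t)"
      using that(1) by (subst DERIV_cong_ev[OF refl e refl])
    then have "((\<lambda>s. (h (t + s) - h t) / s) \<longlongrightarrow> D) (at 0)"
      by (simp add: DERIV_def)
    moreover have "filterlim (\<lambda>i. inverse (real (Suc i))) (at 0) sequentially"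
      using LIMSEQ_inverse_real_of_nat by (auto simp: filterlim_at simp del: of_nat_Suc)
    ultimately have "(\<lambda>i. (h (t + inverse (real (Suc i))) - h t) / inverse (real (Suc i))) \<longlonglongrightarrow> D"
      by (rule filterlim_compose)
    then show ?thesis
      by (simp add: divide_inverse)
  qed
  have F1: "F1 (t, x) = \<phi>' t x" if "t \<in> {0<..<1}" "x \<in> space M - N" for t x
    unfolding F1_def fst_conv snd_conv
    by (rule limI, rule quotient[where h = "\<lambda>t. F0 (t, x)" and g = "\<lambda>s. \<phi> s x"])
      (use that good[of x] cl in \<open>auto simp: F0_def\<close>)
  have F2: "F2 (t, x) = \<phi>'' t x" if "t \<in> {0<..<1}" "x \<in> space M - N" for t x
    unfolding F2_def fst_conv snd_conv
    by (rule limI, rule quotient[where h = "\<lambda>t. F1 (t, x)" and g = "\<lambda>s. \<phi>' s x"])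
      (use that good[of x] F1 in auto)
  have "(\<integral>\<^sup>+x. ennreal (2 * (\<phi> 1 x - \<phi> 0 x)\<^sup>2) \<partial>M)
      \<le> (\<integral>\<^sup>+x. \<integral>\<^sup>+t. ennreal (indicator {0..1} t * ((1 - t) * (F2 (t, x))\<^sup>2)) \<partial>lborel \<partial>M)"
  proof (rule nn_integral_mono_AE, use AE_N AE_space in eventually_elim)
    fix x assume x: "x \<notin> N" "x \<in> space M"
    show "ennreal (2 * (\<phi> 1 x - \<phi> 0 x)\<^sup>2)
      \<le> (\<integral>\<^sup>+t. ennreal (indicator {0..1} t * ((1 - t) * (F2 (t, x))\<^sup>2)) \<partial>lborel)"
      by (rule taylor_remainder_sq_le[where \<phi>' = "\<lambda>t. \<phi>' t x" and \<phi>'' = "\<lambda>t. \<phi>'' t x"])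
        (use x good[of x] F2 in auto)
  qed
  \<comment> \<open>Tonelli rests on the joint measurability of \<open>F2\<close>.\<close>
  also have "\<dots> = (\<integral>\<^sup>+t. \<integral>\<^sup>+x. ennreal (indicator {0..1} t * ((1 - t) * (F2 (t, x))\<^sup>2)) \<partial>M \<partial>lborel)"
    by (rule Fubini') measurable
  also have "\<dots> \<le> (\<integral>\<^sup>+t. ennreal (indicator {0..1} t * (1 - t)) * K \<partial>lborel)"
  proof (rule nn_integral_mono_AE)
    \<comment> \<open>The endpoints are discarded as a null set because \<open>F2\<close> is
      identified with \<open>\<phi>''\<close> at interior times only.\<close>
    have "AE t in lborel. t \<noteq> (0::real)" "AE t in lborel. t \<noteq> (1::real)"
      by (auto intro: AE_lborel_singleton)
    then show "AE t in lborel. (\<integral>\<^sup>+x. ennreal (indicator {0..1} t * ((1 - t) * (F2 (t, x))\<^sup>2)) \<partial>M)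
        \<le> ennreal (indicator {0..1} t * (1 - t)) * K"
    proof eventually_elim
      fix t :: real assume t: "t \<noteq> 0" "t \<noteq> 1"
      show "(\<integral>\<^sup>+x. ennreal (indicator {0..1} t * ((1 - t) * (F2 (t, x))\<^sup>2)) \<partial>M)
        \<le> ennreal (indicator {0..1} t * (1 - t)) * K"
      proof (cases "t \<in> {0<..<1}")
        case True
        have "(\<integral>\<^sup>+x. ennreal (indicator {0..1} t * ((1 - t) * (F2 (t, x))\<^sup>2)) \<partial>M)
            = (\<integral>\<^sup>+x. ennreal (1 - t) * ennreal ((F2 (t, x))\<^sup>2) \<partial>M)"
          using True by (simp add: ennreal_mult)
        also have "\<dots> = ennreal (1 - t) * (\<integral>\<^sup>+x. ennreal ((F2 (t, x))\<^sup>2) \<partial>M)"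
          by (rule nn_integral_cmult) measurable
        also have "(\<integral>\<^sup>+x. ennreal ((F2 (t, x))\<^sup>2) \<partial>M) = (\<integral>\<^sup>+x. ennreal ((\<phi>'' t x)\<^sup>2) \<partial>M)"
          by (rule nn_integral_cong_AE, use AE_N AE_space in eventually_elim) (use True F2 in auto)
        also have "ennreal (1 - t) * \<dots> \<le> ennreal (1 - t) * K"
          using K[of t] True by (intro mult_left_mono) auto
        finally show ?thesis
          using True by simp
      qed (use t in auto)
    qed
  qed
  also have "\<dots> = (\<integral>\<^sup>+t. ennreal (indicator {0..1} t * (1 - t)) \<partial>lborel) * K"
    by (rule nn_integral_multc) measurable
  also have "(\<integral>\<^sup>+t. ennreal (indicator {0..1} t * (1 - t)) \<partial>lborel) = ennreal (1 / 2)"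
  proof -
    have "(\<integral>\<^sup>+t. ennreal (1 - t) * indicator {0..1} t \<partial>lborel) = ennreal ((1 - 1\<^sup>2 / 2) - (0 - 0\<^sup>2 / 2))"
      by (rule nn_integral_FTC_Icc[where F = "\<lambda>t. t - t\<^sup>2 / 2"]) (auto intro!: derivative_eq_intros)
    moreover have "(\<integral>\<^sup>+t. ennreal (indicator {0..1} t * (1 - t)) \<partial>lborel)
        = (\<integral>\<^sup>+t. ennreal (1 - t) * indicator {0..1} (t::real) \<partial>lborel)"
      by (rule nn_integral_cong) (simp split: split_indicator)
    ultimately show ?thesis by simp
  qed
  also have "(\<integral>\<^sup>+x. ennreal (2 * (\<phi> 1 x - \<phi> 0 x)\<^sup>2) \<partial>M) = 2 * (\<integral>\<^sup>+x. ennreal ((\<phi> 1 x - \<phi> 0 x)\<^sup>2) \<partial>M)"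
    by (subst nn_integral_cmult[symmetric]) (auto simp: ennreal_mult)
  finally have "2 * (\<integral>\<^sup>+x. ennreal ((\<phi> 1 x - \<phi> 0 x)\<^sup>2) \<partial>M) \<le> ennreal (1 / 2) * K" .
  then have *: "ennreal (1 / 2) * (2 * (\<integral>\<^sup>+x. ennreal ((\<phi> 1 x - \<phi> 0 x)\<^sup>2) \<partial>M)) \<le> ennreal (1 / 2) * (ennreal (1 / 2) * K)"
    by (rule mult_left_mono) simp
  have "ennreal (1 / 2) * (2 * (\<integral>\<^sup>+x. ennreal ((\<phi> 1 x - \<phi> 0 x)\<^sup>2) \<partial>M)) = (\<integral>\<^sup>+x. ennreal ((\<phi> 1 x - \<phi> 0 x)\<^sup>2) \<partial>M)"
  proof -
    have "ennreal (1 / 2) * ennreal 2 = 1"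
      by (subst ennreal_mult[symmetric]) auto
    then show ?thesis
      by (simp only: ennreal_numeral mult.assoc[symmetric] mult_1)
  qed
  moreover have "ennreal (1 / 2) * (ennreal (1 / 2) * K) = K / 4"
  proof -
    have "ennreal (1 / 2) * ennreal (1 / 2) = inverse 4"
      using inverse_ennreal[of 4] by (subst ennreal_mult[symmetric]) (auto simp: inverse_eq_divide)
    then show ?thesis
      by (metis divide_ennreal_def mult.commute mult.assoc)
  qed
  ultimately show ?thesis
    using * by simp
qed

section \<open>Mean-square norms with values in the extended half-line\<close>

lemma ennsqrt_le_iff: "ennsqrt a \<le> b \<longleftrightarrow> a \<le> b\<^sup>2"
proof (cases a; cases b)
  fix r s :: real assume "0 \<le> r" "a = ennreal r" "0 \<le> s" "b = ennreal s"
  then show ?thesis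
    by (auto simp: ennsqrt_def ennreal_power sqrt_le_D real_le_lsqrt)
qed (auto simp: ennsqrt_def top_unique ennreal_power)

lemma ennsqrt_power2: "ennsqrt (a\<^sup>2) = a"
  by (cases a) (auto simp: ennsqrt_def ennreal_power)

lemma power2_ennsqrt: "(ennsqrt a)\<^sup>2 = a"
  by (cases a) (auto simp: ennsqrt_def ennreal_power)

text \<open>Minkowski's inequality: the square is expanded and the cross term bounded by
  Cauchy-Schwarz. Infinite norms are allowed, because calibration errors are not assumed
  finite.\<close>

lemma ennsqrt_nn_integral_power2_add_le:
  fixes u v :: "'a \<Rightarrow> real"
  assumes [measurable]: "u \<in> borel_measurable M" "v \<in> borel_measurable M"
  shows "ennsqrt (\<integral>\<^sup>+x. ennreal ((u x + v x)\<^sup>2) \<partial>M)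
    \<le> ennsqrt (\<integral>\<^sup>+x. ennreal ((u x)\<^sup>2) \<partial>M) + ennsqrt (\<integral>\<^sup>+x. ennreal ((v x)\<^sup>2) \<partial>M)"
proof -
  define A where "A = (\<integral>\<^sup>+x. ennreal ((u x)\<^sup>2) \<partial>M)"
  define B where "B = (\<integral>\<^sup>+x. ennreal ((v x)\<^sup>2) \<partial>M)"
  define C where "C = (\<integral>\<^sup>+x. ennreal \<bar>u x\<bar> * ennreal \<bar>v x\<bar> \<partial>M)"
  have "C\<^sup>2 \<le> (\<integral>\<^sup>+x. (ennreal \<bar>u x\<bar>)\<^sup>2 \<partial>M) * (\<integral>\<^sup>+x. (ennreal \<bar>v x\<bar>)\<^sup>2 \<partial>M)"
    unfolding C_def by (rule Cauchy_Schwarz_nn_integral) measurable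
  also have "\<dots> = (ennsqrt A * ennsqrt B)\<^sup>2"
    by (simp add: A_def B_def ennreal_power power_mult_distrib power2_ennsqrt)
  finally have C: "C \<le> ennsqrt A * ennsqrt B"
    by (simp flip: ennsqrt_le_iff add: ennsqrt_power2)
  have "(\<integral>\<^sup>+x. ennreal ((u x + v x)\<^sup>2) \<partial>M)
      \<le> (\<integral>\<^sup>+x. ennreal ((u x)\<^sup>2) + 2 * (ennreal \<bar>u x\<bar> * ennreal \<bar>v x\<bar>) + ennreal ((v x)\<^sup>2) \<partial>M)"
  proof (rule nn_integral_mono)
    fix x
    have "(u x + v x)\<^sup>2 \<le> (u x)\<^sup>2 + 2 * (\<bar>u x\<bar> * \<bar>v x\<bar>) + (v x)\<^sup>2"
      using abs_ge_self[of "u x * v x"] by (simp add: power2_sum abs_mult)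
    then have "ennreal ((u x + v x)\<^sup>2) \<le> ennreal ((u x)\<^sup>2 + 2 * (\<bar>u x\<bar> * \<bar>v x\<bar>) + (v x)\<^sup>2)"
      by (rule ennreal_leI)
    then show "ennreal ((u x + v x)\<^sup>2) \<le> ennreal ((u x)\<^sup>2) + 2 * (ennreal \<bar>u x\<bar> * ennreal \<bar>v x\<bar>) + ennreal ((v x)\<^sup>2)"
      by (simp add: ennreal_plus ennreal_mult)
  qed
  also have "\<dots> = A + 2 * C + B"
    unfolding A_def B_def C_def by (simp add: nn_integral_add nn_integral_cmult)
  also have "\<dots> \<le> A + 2 * (ennsqrt A * ennsqrt B) + B"
    using C by (intro add_mono mult_left_mono) auto
  also have "\<dots> = (ennsqrt A + ennsqrt B)\<^sup>2"
    unfolding power2_sum power2_ennsqrt by (simp add: ac_simps)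
  finally show ?thesis
    by (simp add: ennsqrt_le_iff A_def B_def)
qed

section \<open>Conditional expectations given random variables\<close>

text \<open>Jensen's inequality for the square, when \<open>f\<close> has a finite second moment;
  otherwise the right-hand side is infinite.\<close>

lemma (in sigma_finite_subalgebra) nn_integral_power2_real_cond_exp_le:
  assumes f: "integrable M f"
  shows "(\<integral>\<^sup>+x. ennreal ((real_cond_exp M F f x)\<^sup>2) \<partial>M) \<le> (\<integral>\<^sup>+x. ennreal ((f x)\<^sup>2) \<partial>M)"
proof (cases "(\<integral>\<^sup>+x. ennreal ((f x)\<^sup>2) \<partial>M) = \<infinity>")
  case False
  have [measurable]: "f \<in> borel_measurable M"
    using f by auto
  have f2: "integrable M (\<lambda>x. (f x)\<^sup>2)"
    using False by (intro integrableI_bounded) (auto simp: top.not_eq_extremum)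
  have "AE x in M. (real_cond_exp M F f x)\<^sup>2 \<le> real_cond_exp M F (\<lambda>x. (f x)\<^sup>2) x"
    by (rule real_cond_exp_jensens_inequality(2)[where I = UNIV and q = "\<lambda>x. x\<^sup>2"])
      (use f f2 in \<open>auto intro: convex_power2\<close>)
  then have "(\<integral>\<^sup>+x. ennreal ((real_cond_exp M F f x)\<^sup>2) \<partial>M) \<le> (\<integral>\<^sup>+x. ennreal (real_cond_exp M F (\<lambda>x. (f x)\<^sup>2) x) \<partial>M)"
    by (intro nn_integral_mono_AE) (auto elim!: eventually_mono intro: ennreal_leI)
  also have "\<dots> = ennreal (\<integral>x. real_cond_exp M F (\<lambda>x. (f x)\<^sup>2) x \<partial>M)"
    using real_cond_exp_pos[of "\<lambda>x. (f x)\<^sup>2"] by (intro nn_integral_eq_integral real_cond_exp_int(1) f2) auto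
  also have "\<dots> = (\<integral>\<^sup>+x. ennreal ((f x)\<^sup>2) \<partial>M)"
    by (simp add: real_cond_exp_int(2) f2 nn_integral_eq_integral)
  finally show ?thesis .
qed simp

lemma measurable_sigma_rv: "U \<in> M \<rightarrow>\<^sub>M N \<Longrightarrow> U \<in> sigma_rv M U N \<rightarrow>\<^sub>M N"
  unfolding sigma_rv_def by (intro measurable_vimage_algebra1) (auto dest: measurable_space)

lemma sets_sigma_rv: "U \<in> M \<rightarrow>\<^sub>M N \<Longrightarrow> sets (sigma_rv M U N) = {U -` B \<inter> space M |B. B \<in> sets N}"
  unfolding sigma_rv_def by (subst sets_vimage_algebra2) (auto dest: measurable_space)

lemma subalgebra_sigma_rv:
  assumes "U \<in> M \<rightarrow>\<^sub>M N"
  shows "subalgebra M (sigma_rv M U N)"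
  using assms unfolding subalgebra_def sets_sigma_rv[OF assms] by (auto simp: sigma_rv_def)

text \<open>Supplies the inclusion of sigma-algebras for the tower property, from conditioning on
  \<open>X\<close> to conditioning on \<open>\<theta> (X z)\<close>.\<close>

lemma subalgebra_sigma_rv_comp:
  assumes U: "U \<in> M \<rightarrow>\<^sub>M N" and f: "f \<in> N \<rightarrow>\<^sub>M K"
  shows "subalgebra (sigma_rv M U N) (sigma_rv M (\<lambda>x. f (U x)) K)"
proof -
  have "(\<lambda>x. f (U x)) \<in> sigma_rv M U N \<rightarrow>\<^sub>M K"
    by (rule measurable_compose[OF measurable_sigma_rv[OF U] f])
  from subalgebra_sigma_rv[OF this] show ?thesis
    by (simp add: sigma_rv_def)
qed

lemma sigma_finite_subalgebra_sigma_rv: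
  assumes "prob_space M" "U \<in> M \<rightarrow>\<^sub>M N"
  shows "sigma_finite_subalgebra M (sigma_rv M U N)"
proof -
  interpret prob_space M by fact
  interpret finite_measure_subalgebra M "sigma_rv M U N"
    by standard (rule subalgebra_sigma_rv[OF assms(2)])
  show ?thesis by unfold_locales
qed

text \<open>The sets generated by \<open>U\<close> after \<open>T\<close> are the
  \<open>T\<close>-preimages of the sets generated by \<open>U\<close>, so the integrals
  characterising the two conditional expectations match by change of variables. This moves the
  classical calibration error from the law of the pseudo-outcomes back to the data space.\<close>

lemma real_cond_exp_distr:
  assumes P: "prob_space P" and T[measurable]: "T \<in> P \<rightarrow>\<^sub>M M" and U[measurable]: "U \<in> M \<rightarrow>\<^sub>M N"
    and f: "integrable (distr P M T) f"
  shows "AE z in P. real_cond_exp P (sigma_rv P (\<lambda>z. U (T z)) N) (\<lambda>z. f (T z)) z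
    = real_cond_exp (distr P M T) (sigma_rv (distr P M T) U N) f (T z)"
proof -
  let ?Q = "distr P M T"
  let ?FQ = "sigma_rv ?Q U N" and ?FP = "sigma_rv P (\<lambda>z. U (T z)) N"
  have [measurable]: "f \<in> borel_measurable M"
    using f by (auto dest: borel_measurable_integrable)
  interpret P: prob_space P by fact
  have Q: "prob_space ?Q"
    by (rule P.prob_space_distr) fact
  have UQ: "U \<in> ?Q \<rightarrow>\<^sub>M N"
    by simp
  interpret FP: sigma_finite_subalgebra P ?FP
    by (rule sigma_finite_subalgebra_sigma_rv[OF P]) simp
  interpret FQ: sigma_finite_subalgebra ?Q ?FQ
    by (rule sigma_finite_subalgebra_sigma_rv[OF Q UQ])
  have c[measurable]: "real_cond_exp ?Q ?FQ f \<in> borel_measurable M"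
    using borel_measurable_cond_exp2[of ?Q ?FQ f] by simp
  show ?thesis
  proof (rule FP.real_cond_exp_charact)
    fix A assume "A \<in> sets ?FP"
    then obtain B where B[measurable]: "B \<in> sets N" and A: "A = (\<lambda>z. U (T z)) -` B \<inter> space P"
      by (subst (asm) sets_sigma_rv) auto
    define A' where "A' = U -` B \<inter> space M"
    have [measurable]: "A' \<in> sets M"
      unfolding A'_def by measurable
    have "A' \<in> sets ?FQ"
      unfolding sets_sigma_rv[OF UQ] A'_def using B by auto
    have transfer: "(\<integral>z\<in>A. h (T z) \<partial>P) = (\<integral>q\<in>A'. h q \<partial>?Q)" if [measurable]: "h \<in> borel_measurable M" for h :: "_ \<Rightarrow> real"
      unfolding set_lebesgue_integral_def
      by (subst integral_distr)
        (auto intro!: Bochner_Integration.integral_cong simp: A A'_def indicator_def dest: measurable_space[OF T])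
    show "(\<integral>z\<in>A. f (T z) \<partial>P) = (\<integral>z\<in>A. real_cond_exp ?Q ?FQ f (T z) \<partial>P)"
      unfolding transfer[OF \<open>f \<in> borel_measurable M\<close>] transfer[OF c]
      by (rule FQ.real_cond_exp_intA) fact+
  next
    show "integrable P (\<lambda>z. f (T z))"
      using f by (simp add: integrable_distr_eq)
    show "integrable P (\<lambda>z. real_cond_exp ?Q ?FQ f (T z))"
      using FQ.real_cond_exp_int(1)[OF f] by (simp add: integrable_distr_eq)
    have "T \<in> ?FP \<rightarrow>\<^sub>M ?FQ"
      unfolding sigma_rv_def
      by (intro measurable_vimage_algebra2 measurable_vimage_algebra1)
        (auto dest: measurable_space[OF T] measurable_space[OF U])
    then show "(\<lambda>z. real_cond_exp ?Q ?FQ f (T z)) \<in> borel_measurable ?FP"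
      by measurable
  qed
qed

section \<open>Comparison of the causal and the classical calibration error\<close>

text \<open>Since \<open>\<theta>(X)\<close> need not be integrable, the tower property is only available after truncating \<open>\<theta>\<close>.\<close>

lemma real_cond_exp_dloss:
  assumes P: "prob_space P" and X[measurable]: "X \<in> P \<rightarrow>\<^sub>M MX" and \<theta>[measurable]: "\<theta> \<in> borel_measurable MX"
    and dloss_meas: "\<And>\<theta>. \<theta> \<in> borel_measurable MX \<Longrightarrow> dloss l X \<theta> g \<in> borel_measurable P"
    and dloss_int: "\<And>\<theta>. \<theta> \<in> borel_measurable MX \<Longrightarrow> integrable P (\<lambda>z. \<theta> (X z)) \<Longrightarrow> integrable P (dloss l X \<theta> g)"
    and c_int: "integrable P c"
    and c: "\<And>\<theta>. \<theta> \<in> borel_measurable MX \<Longrightarrow>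
      AE z in P. real_cond_exp P (sigma_rv P X MX) (dloss l X \<theta> g) z = \<theta> (X z) - real_cond_exp P (sigma_rv P X MX) c z"
  shows "AE z in P. real_cond_exp P (sigma_rv P (\<lambda>z. \<theta> (X z)) borel) (dloss l X \<theta> g) z
    = \<theta> (X z) - real_cond_exp P (sigma_rv P (\<lambda>z. \<theta> (X z)) borel) c z"
proof -
  let ?F = "sigma_rv P (\<lambda>z. \<theta> (X z)) borel" and ?H = "sigma_rv P X MX"
  interpret P: prob_space P by fact
  interpret F: sigma_finite_subalgebra P ?F
    by (rule sigma_finite_subalgebra_sigma_rv[OF P]) simp
  interpret H: sigma_finite_subalgebra P ?H
    by (rule sigma_finite_subalgebra_sigma_rv[OF P X])
  have H: "subalgebra P ?H"
    by (rule subalgebra_sigma_rv[OF X])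
  have HF: "subalgebra ?H ?F"
    by (rule subalgebra_sigma_rv_comp[OF X \<theta>])
  have \<theta>F[measurable]: "(\<lambda>z. \<theta> (X z)) \<in> borel_measurable ?F"
    by (rule measurable_sigma_rv) simp
  have [measurable]: "\<And>\<theta>. \<theta> \<in> borel_measurable MX \<Longrightarrow> dloss l X \<theta> g \<in> borel_measurable P"
    by (rule dloss_meas)
  have "AE z in P. \<bar>\<theta> (X z)\<bar> \<le> real k \<longrightarrow>
      real_cond_exp P ?F (dloss l X \<theta> g) z = \<theta> (X z) - real_cond_exp P ?F c z" for k :: nat
  proof -
    define I :: "'a \<Rightarrow> real" where "I z = indicator {-real k..real k} (\<theta> (X z))" for z
    have IF[measurable]: "I \<in> borel_measurable ?F"
      unfolding I_def[abs_def] by measurable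
    have I[measurable]: "I \<in> borel_measurable P"
      by (rule measurable_from_subalg[OF F.subalg IF])
    \<comment> \<open>The truncated predictor is bounded, so the integrability hypothesis on the
      loss derivative applies to it.\<close>
    define \<theta>k where "\<theta>k x = (if \<bar>\<theta> x\<bar> \<le> real k then \<theta> x else 0)" for x
    have [measurable]: "\<theta>k \<in> borel_measurable MX"
      unfolding \<theta>k_def[abs_def] by measurable
    have "(\<lambda>z. if \<bar>\<theta> (X z)\<bar> \<le> real k then \<theta> (X z) else 0) \<in> borel_measurable ?F"
      by measurable
    then have \<theta>kF: "(\<lambda>z. \<theta>k (X z)) \<in> borel_measurable ?F"
      by (simp add: \<theta>k_def)
    have \<theta>k_int: "integrable P (\<lambda>z. \<theta>k (X z))"
      by (rule P.integrable_const_bound[where B = "real k"]) (auto simp: \<theta>k_def)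
    have Dk_int: "integrable P (dloss l X \<theta>k g)"
      by (rule dloss_int) (use \<theta>k_int in auto)
    have ID_int: "integrable P (\<lambda>z. I z * dloss l X \<theta>k g z)"
      by (rule Bochner_Integration.integrable_bound[OF Dk_int]) (auto simp: I_def split: split_indicator)
    \<comment> \<open>The loss derivative at \<open>z\<close> depends on the predictor only through
      its value at \<open>X z\<close>, so truncation changes nothing where \<open>I\<close> is
      1.\<close>
    have ID: "(\<lambda>z. I z * dloss l X \<theta>k g z) = (\<lambda>z. I z * dloss l X \<theta> g z)"
      by (auto simp: fun_eq_iff I_def dloss_def \<theta>k_def split: split_indicator)
    have "AE z in P. real_cond_exp P ?F (real_cond_exp P ?H (dloss l X \<theta>k g)) z = real_cond_exp P ?F (dloss l X \<theta>k g) z"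
      by (rule F.real_cond_exp_nested_subalg[OF H HF Dk_int])
    moreover have "AE z in P. real_cond_exp P ?F (real_cond_exp P ?H (dloss l X \<theta>k g)) z
        = real_cond_exp P ?F (\<lambda>z. \<theta>k (X z) - real_cond_exp P ?H c z) z"
      by (rule F.real_cond_exp_cong[OF c]) measurable
    moreover have "AE z in P. real_cond_exp P ?F (\<lambda>z. \<theta>k (X z) - real_cond_exp P ?H c z) z
        = real_cond_exp P ?F (\<lambda>z. \<theta>k (X z)) z - real_cond_exp P ?F (real_cond_exp P ?H c) z"
      by (rule F.real_cond_exp_diff[OF \<theta>k_int H.real_cond_exp_int(1)[OF c_int]])
    moreover have "AE z in P. real_cond_exp P ?F (\<lambda>z. \<theta>k (X z)) z = \<theta>k (X z)"
      by (rule F.real_cond_exp_F_meas[OF \<theta>k_int \<theta>kF])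
    moreover have "AE z in P. real_cond_exp P ?F (real_cond_exp P ?H c) z = real_cond_exp P ?F c z"
      by (rule F.real_cond_exp_nested_subalg[OF H HF c_int])
    moreover have "AE z in P. real_cond_exp P ?F (\<lambda>z. I z * dloss l X \<theta>k g z) z = I z * real_cond_exp P ?F (dloss l X \<theta>k g) z"
      by (rule F.real_cond_exp_mult[OF IF _ ID_int]) measurable
    \<comment> \<open>Pulling out \<open>I\<close> asks only for the product to be integrable, while
      the derivative at the untruncated \<open>\<theta>\<close> may fail to be.\<close>
    moreover have "AE z in P. real_cond_exp P ?F (\<lambda>z. I z * dloss l X \<theta> g z) z = I z * real_cond_exp P ?F (dloss l X \<theta> g) z"
      by (rule F.real_cond_exp_mult[OF IF _ ID_int[unfolded ID]]) measurable
    ultimately show ?thesis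
    proof eventually_elim
      case (elim z)
      have "I z = 1" "\<theta>k (X z) = \<theta> (X z)" if "\<bar>\<theta> (X z)\<bar> \<le> real k"
        using that by (auto simp: I_def \<theta>k_def indicator_def abs_le_iff)
      with elim show ?case
        by (auto simp only: ID mult_1)
    qed
  qed
  \<comment> \<open>The exceptional sets of all levels form one null set, and every point lies below
    some truncation level.\<close>
  then have "AE z in P. \<forall>k::nat. \<bar>\<theta> (X z)\<bar> \<le> real k \<longrightarrow>
      real_cond_exp P ?F (dloss l X \<theta> g) z = \<theta> (X z) - real_cond_exp P ?F c z"
    by (subst AE_all_countable) simp
  then show ?thesis
    by eventually_elim (meson real_arch_simple)
qed

text \<open>Two predictors occur: \<open>\<theta>\<close> is the one being assessed, while
  \<open>\<theta>0\<close> serves only to express the conditional mean of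
  \<open>chi g - chi g0\<close> through \<open>ce\<close>. In the application
  \<open>\<theta>\<close> is the calibrated predictor and \<open>\<theta>0\<close> the initial
  one.\<close>

lemma causal_cal_le_classical_cal:
  assumes P: "prob_space P" and X[measurable]: "X \<in> P \<rightarrow>\<^sub>M MX" and \<theta>[measurable]: "\<theta> \<in> borel_measurable MX"
    and dloss_meas: "\<And>\<theta>. \<theta> \<in> borel_measurable MX \<Longrightarrow> dloss l X \<theta> g0 \<in> borel_measurable P"
    and dloss_int: "\<And>\<theta>. \<theta> \<in> borel_measurable MX \<Longrightarrow> integrable P (\<lambda>z. \<theta> (X z)) \<Longrightarrow> integrable P (dloss l X \<theta> g0)"
    and chi_int: "\<And>f. f \<in> {g, g0} \<Longrightarrow> integrable P (chi f)"
    and chi: "\<And>\<theta> f. \<theta> \<in> borel_measurable MX \<Longrightarrow> f \<in> {g, g0} \<Longrightarrow>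
      AE z in P. real_cond_exp P (sigma_rv P X MX) (dloss l X \<theta> f) z = \<theta> (X z) - real_cond_exp P (sigma_rv P X MX) (chi f) z"
    and \<theta>0: "\<theta>0 \<in> borel_measurable MX"
    and ce: "\<And>f. f \<in> {g, g0} \<Longrightarrow> cond_exp_version P X MX (dloss l X \<theta>0 f) (ce f)"
  shows "causal_cal P l X \<theta> g0 \<le> ennsqrt (\<integral>\<^sup>+x. ennreal ((ce g x - ce g0 x)\<^sup>2) \<partial>distr P MX X)
    + classical_cal \<theta> (pseudo_outcome_law P MX X chi g)"
proof -
  let ?F = "sigma_rv P (\<lambda>z. \<theta> (X z)) borel" and ?H = "sigma_rv P X MX"
  interpret P: prob_space P by fact
  interpret F: sigma_finite_subalgebra P ?F
    by (rule sigma_finite_subalgebra_sigma_rv[OF P]) simp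
  interpret H: sigma_finite_subalgebra P ?H
    by (rule sigma_finite_subalgebra_sigma_rv[OF P X])
  have H: "subalgebra P ?H"
    by (rule subalgebra_sigma_rv[OF X])
  have HF: "subalgebra ?H ?F"
    by (rule subalgebra_sigma_rv_comp[OF X \<theta>])
  have g: "integrable P (chi g)" and g0: "integrable P (chi g0)"
    using chi_int by auto
  then have diff_int: "integrable P (\<lambda>z. chi g z - chi g0 z)"
    by (rule Bochner_Integration.integrable_diff)
  have [measurable]: "chi g \<in> borel_measurable P" "chi g0 \<in> borel_measurable P"
    using g g0 by auto
  have [measurable]: "ce g \<in> borel_measurable MX" "ce g0 \<in> borel_measurable MX"
    using ce by (auto simp: cond_exp_version_def)
  \<comment> \<open>\<open>?u\<close> is the calibration residual for the pseudo-outcomes built from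
    \<open>g\<close>; \<open>?v\<close> is the cost of using \<open>g\<close> instead of
    \<open>g0\<close>. Writing \<open>?v\<close> as an iterated conditional expectation lets the
    contraction property bound it by quantities conditioned on \<open>X\<close>.\<close>
  let ?u = "\<lambda>z. \<theta> (X z) - real_cond_exp P ?F (chi g) z"
  let ?v = "\<lambda>z. real_cond_exp P ?F (real_cond_exp P ?H (\<lambda>z. chi g z - chi g0 z)) z"
  have "AE z in P. real_cond_exp P ?F (dloss l X \<theta> g0) z = \<theta> (X z) - real_cond_exp P ?F (chi g0) z"
    by (rule real_cond_exp_dloss[OF P X \<theta> dloss_meas dloss_int g0 chi]) auto
  moreover have "AE z in P. real_cond_exp P ?F (\<lambda>z. chi g z - chi g0 z) z
      = real_cond_exp P ?F (chi g) z - real_cond_exp P ?F (chi g0) z"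
    by (rule F.real_cond_exp_diff[OF g g0])
  moreover have "AE z in P. ?v z = real_cond_exp P ?F (\<lambda>z. chi g z - chi g0 z) z"
    by (rule F.real_cond_exp_nested_subalg[OF H HF diff_int])
  ultimately have "AE z in P. real_cond_exp P ?F (dloss l X \<theta> g0) z = ?u z + ?v z"
    by eventually_elim simp
  then have "causal_cal P l X \<theta> g0 = ennsqrt (\<integral>\<^sup>+z. ennreal ((?u z + ?v z)\<^sup>2) \<partial>P)"
    unfolding causal_cal_def
    by (intro arg_cong[where f = ennsqrt] nn_integral_cong_AE) (auto elim!: eventually_mono)
  also have "\<dots> \<le> ennsqrt (\<integral>\<^sup>+z. ennreal ((?u z)\<^sup>2) \<partial>P) + ennsqrt (\<integral>\<^sup>+z. ennreal ((?v z)\<^sup>2) \<partial>P)"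
    by (rule ennsqrt_nn_integral_power2_add_le) measurable
  also have "ennsqrt (\<integral>\<^sup>+z. ennreal ((?u z)\<^sup>2) \<partial>P) = classical_cal \<theta> (pseudo_outcome_law P MX X chi g)"
  proof -
    let ?T = "\<lambda>z. (X z, chi g z)" and ?M = "MX \<Otimes>\<^sub>M borel :: ('b \<times> real) measure"
    let ?Q = "distr P ?M ?T"
    let ?FQ = "sigma_rv ?Q (\<lambda>p. \<theta> (fst p)) borel"
    have [measurable]: "real_cond_exp ?Q ?FQ snd \<in> borel_measurable ?M"
      using borel_measurable_cond_exp2[of ?Q ?FQ snd] by simp
    have "integrable ?Q snd"
      using g by (simp add: integrable_distr_eq)
    then have "AE z in P. real_cond_exp P ?F (chi g) z = real_cond_exp ?Q ?FQ snd (?T z)"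
      using real_cond_exp_distr[OF P, of ?T ?M "\<lambda>p. \<theta> (fst p)" borel snd] by simp
    then have "(\<integral>\<^sup>+z. ennreal ((?u z)\<^sup>2) \<partial>P) = (\<integral>\<^sup>+z. ennreal ((\<theta> (fst (?T z)) - real_cond_exp ?Q ?FQ snd (?T z))\<^sup>2) \<partial>P)"
      by (intro nn_integral_cong_AE) (auto elim!: eventually_mono)
    also have "\<dots> = (\<integral>\<^sup>+p. ennreal ((\<theta> (fst p) - real_cond_exp ?Q ?FQ snd p)\<^sup>2) \<partial>?Q)"
      by (rule nn_integral_distr[symmetric]) measurable
    finally show ?thesis
      by (simp add: classical_cal_def pseudo_outcome_law_def)
  qed
  finally have le: "causal_cal P l X \<theta> g0 \<le> classical_cal \<theta> (pseudo_outcome_law P MX X chi g)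
    + ennsqrt (\<integral>\<^sup>+z. ennreal ((?v z)\<^sup>2) \<partial>P)" .
  have "(\<integral>\<^sup>+z. ennreal ((?v z)\<^sup>2) \<partial>P) \<le> (\<integral>\<^sup>+x. ennreal ((ce g x - ce g0 x)\<^sup>2) \<partial>distr P MX X)"
  proof -
    have "(\<integral>\<^sup>+z. ennreal ((?v z)\<^sup>2) \<partial>P) \<le> (\<integral>\<^sup>+z. ennreal ((real_cond_exp P ?H (\<lambda>z. chi g z - chi g0 z) z)\<^sup>2) \<partial>P)"
      by (rule F.nn_integral_power2_real_cond_exp_le[OF H.real_cond_exp_int(1)[OF diff_int]])
    also have "\<dots> = (\<integral>\<^sup>+z. ennreal ((ce g (X z) - ce g0 (X z))\<^sup>2) \<partial>P)"
    proof (rule nn_integral_cong_AE)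
      \<comment> \<open>Subtracting these identities for \<open>g\<close> and \<open>g0\<close>
        cancels \<open>\<theta>0 (X z)\<close> and leaves minus the difference of the
        \<open>ce\<close> terms; the square absorbs the sign.\<close>
      have "AE z in P. real_cond_exp P ?H (chi f) z = \<theta>0 (X z) - ce f (X z)" if "f \<in> {g, g0}" for f
      proof -
        have "AE z in P. real_cond_exp P ?H (dloss l X \<theta>0 f) z = ce f (X z)"
          using ce[OF that] by (simp add: cond_exp_version_def)
        with chi[OF \<theta>0 that] show ?thesis
          by eventually_elim simp
      qed
      from this[of g] this[of g0]
      have "AE z in P. real_cond_exp P ?H (chi g) z = \<theta>0 (X z) - ce g (X z)"
        "AE z in P. real_cond_exp P ?H (chi g0) z = \<theta>0 (X z) - ce g0 (X z)"
        by auto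
      with H.real_cond_exp_diff[OF g g0]
      show "AE z in P. ennreal ((real_cond_exp P ?H (\<lambda>z. chi g z - chi g0 z) z)\<^sup>2)
          = ennreal ((ce g (X z) - ce g0 (X z))\<^sup>2)"
        by eventually_elim (simp add: power2_commute)
    qed
    also have "\<dots> = (\<integral>\<^sup>+x. ennreal ((ce g x - ce g0 x)\<^sup>2) \<partial>distr P MX X)"
      by (rule nn_integral_distr[symmetric]) measurable
    finally show ?thesis .
  qed
  then have "ennsqrt (\<integral>\<^sup>+z. ennreal ((?v z)\<^sup>2) \<partial>P) \<le> ennsqrt (\<integral>\<^sup>+x. ennreal ((ce g x - ce g0 x)\<^sup>2) \<partial>distr P MX X)"
    by (simp add: ennsqrt_le_iff power2_ennsqrt)
  then show ?thesis
    by (subst add.commute) (rule order_trans[OF le add_left_mono])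
qed

section \<open>Gateaux derivatives along the line between two nuisances\<close>

text \<open>Differentiability is not assumed: both sides choose from the same set of candidate
  derivatives.\<close>

lemma deriv_shift: "deriv (\<lambda>r. f (t + r)) s = deriv f (t + s)" for f :: "real \<Rightarrow> real"
  using DERIV_shift[of f _ s t] by (simp add: deriv_def add.commute)

lemma shift_shift: "shift (shift f h t) h s = shift f h (t + s)"
  by (simp add: shift_def algebra_simps)

text \<open>The Taylor expansion runs in direction \<open>h = g - g\<^sub>0\<close>, whereas \<open>nuisance_err\<close> differentiates in direction
  \<open>g\<^sub>0 - g\<close>; hence the sign in the second conclusion.\<close>

lemma gateaux2_existsD:
  assumes "gateaux2_exists G T (shift f h t) h"
  shows "((\<lambda>s. T (shift f h s)) has_real_derivative deriv (\<lambda>s. T (shift f h s)) t) (at t)"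
    and "(deriv (\<lambda>s. T (shift f h s)) has_real_derivative gateaux2 T (shift f h t) (\<lambda>w. - h w)) (at t)"
proof -
  define \<phi> where "\<phi> s = T (shift f h s)" for s
  have ev: "\<forall>\<^sub>F s in nhds 0. (\<lambda>r. \<phi> (t + r)) differentiable (at s)"
    and "deriv (\<lambda>r. \<phi> (t + r)) differentiable (at 0)"
    using assms by (auto simp: gateaux2_exists_def shift_shift \<phi>_def)
  then have "(\<lambda>s. deriv \<phi> (t + s)) differentiable (at 0)"
    by (simp add: deriv_shift[abs_def])
  then obtain D where "((\<lambda>s. deriv \<phi> (t + s)) has_real_derivative D) (at 0)"
    by (auto simp: real_differentiable_def)
  then have D: "(deriv \<phi> has_real_derivative D) (at t)"
    using DERIV_shift[of "deriv \<phi>" D 0 t] by (simp add: add.commute)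
  have \<phi>: "(\<phi> has_real_derivative deriv \<phi> (t + s)) (at (t + s))"
    if "(\<lambda>r. \<phi> (t + r)) differentiable (at s)" for s
  proof -
    from that obtain E where "((\<lambda>r. \<phi> (t + r)) has_real_derivative E) (at s)"
      by (auto simp: real_differentiable_def)
    then have "(\<phi> has_real_derivative E) (at (t + s))"
      using DERIV_shift[of \<phi> E s t] by (simp add: add.commute)
    then show ?thesis
      by (simp add: DERIV_imp_deriv)
  qed
  show "((\<lambda>s. T (shift f h s)) has_real_derivative deriv (\<lambda>s. T (shift f h s)) t) (at t)"
    using \<phi>[OF eventually_nhds_x_imp_x[OF ev]] by (simp add: \<phi>_def[abs_def])
  have reflect: "((\<lambda>r. f (t - r)) has_real_derivative - E) (at s)"
    if "(f has_real_derivative E) (at (t - s))" for f :: "real \<Rightarrow> real" and E s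
  proof -
    have "((\<lambda>r. t - r) has_real_derivative - 1) (at s)"
      by (auto intro!: derivative_eq_intros)
    from DERIV_chain2[OF that this] show ?thesis
      by simp
  qed
  \<comment> \<open>The reflected path is the line in direction \<open>- h\<close>. Its first
    derivative is needed on a whole neighbourhood of 0, since it is differentiated again; the two
    sign changes then cancel.\<close>
  have "\<forall>\<^sub>F s in nhds 0. (\<lambda>r. \<phi> (t + r)) differentiable (at (- s))"
    using ev by (subst eventually_filtermap[symmetric, where f = uminus])
      (simp add: filtermap_nhds_minus)
  then have "\<forall>\<^sub>F s in nhds 0. deriv (\<lambda>r. \<phi> (t - r)) s = - deriv \<phi> (t - s)"
  proof eventually_elim
    case (elim s)
    have "((\<lambda>r. \<phi> (t - r)) has_real_derivative - deriv \<phi> (t - s)) (at s)"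
      using \<phi>[OF elim] by (intro reflect) simp
    then show ?case
      by (rule DERIV_imp_deriv)
  qed
  moreover have "((\<lambda>s. - deriv \<phi> (t - s)) has_real_derivative D) (at 0)"
    using DERIV_minus[OF reflect[of "deriv \<phi>" D 0]] D by simp
  ultimately have "(deriv (\<lambda>r. \<phi> (t - r)) has_real_derivative D) (at 0)"
    by (subst DERIV_cong_ev[OF refl _ refl])
  then have "deriv (deriv (\<lambda>r. \<phi> (t - r))) 0 = D"
    by (rule DERIV_imp_deriv)
  moreover have "shift (shift f h t) (\<lambda>w. - h w) s = shift f h (t - s)" for s
    by (simp add: shift_def algebra_simps)
  ultimately have "gateaux2 T (shift f h t) (\<lambda>w. - h w) = D"
    by (simp add: gateaux2_def \<phi>_def)
  then show "(deriv (\<lambda>s. T (shift f h s)) has_real_derivative gateaux2 T (shift f h t) (\<lambda>w. - h w)) (at t)"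
    using D by (simp add: \<phi>_def[abs_def])
qed

text \<open>The line from \<open>g0\<close> to \<open>g\<close> stays in the segment, so the
  supremum bounds the norm of the second derivative uniformly in \<open>t\<close>. Orthogonality
  removes the first derivative at the starting point, and the mean-square Taylor bound
  applies.\<close>

lemma ennsqrt_nn_integral_diff_le_nuisance_err:
  assumes PX: "sigma_finite_measure PX"
    and g: "g0 \<in> G" and seg: "nuisance_segment MW g g0 \<subseteq> G"
    and meas: "\<And>f. f \<in> G \<Longrightarrow> T f \<in> borel_measurable PX"
    and orth: "AE x in PX. gateaux1 (\<lambda>f. T f x) g0 (\<lambda>w. g w - g0 w) = 0"
    and second: "AE x in PX. \<forall>f\<in>G. gateaux2_exists G (\<lambda>u. T u x) f (\<lambda>w. g w - g0 w)"
  shows "ennsqrt (\<integral>\<^sup>+x. ennreal ((T g x - T g0 x)\<^sup>2) \<partial>PX) \<le> ennreal (1 / 2) * nuisance_err PX MW T g g0"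
proof -
  define h where "h w = g w - g0 w" for w
  define \<phi> where "\<phi> t x = T (shift g0 h t) x" for t x
  define \<phi>' where "\<phi>' t x = deriv (\<lambda>s. \<phi> s x) t" for t x
  define \<phi>'' where "\<phi>'' t x = gateaux2 (\<lambda>u. T u x) (shift g0 h t) (\<lambda>w. g0 w - g w)" for t x
  let ?K = "nuisance_err PX MW T g g0"
  have minus_h: "(\<lambda>w. - h w) = (\<lambda>w. g0 w - g w)"
    by (simp add: h_def)
  have h: "(\<lambda>w. g w - g0 w) = h"
    by (simp add: h_def[abs_def])
  have segment: "shift g0 h t \<in> nuisance_segment MW g g0" if "t \<in> {0..1}" for t
    unfolding nuisance_segment_def using that
    \<comment> \<open>The weight function is the constant \<open>t\<close>, since \<open>t\<close>
      times \<open>g\<close> plus \<open>1 - t\<close> times \<open>g0\<close> is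
      \<open>g0 + t * h\<close>.\<close>
    by (intro CollectI exI[of _ "\<lambda>_. t"]) (auto simp: shift_def h_def algebra_simps)
  have inG: "shift g0 h t \<in> G" if "t \<in> {0..1}" for t
    using segment[OF that] seg by auto
  have "(\<integral>\<^sup>+x. ennreal ((\<phi> 1 x - \<phi> 0 x)\<^sup>2) \<partial>PX) \<le> ?K\<^sup>2 / 4"
  proof (rule nn_integral_taylor_remainder_sq_le[where \<phi>' = \<phi>' and \<phi>'' = \<phi>''])
    show "\<phi> t \<in> borel_measurable PX" if "t \<in> {0..1}" for t
      using meas[OF inG[OF that]] by (simp add: \<phi>_def[abs_def])
    have exists: "AE x in PX. \<forall>t\<in>{0..1}. gateaux2_exists G (\<lambda>u. T u x) (shift g0 h t) h"
      using second by eventually_elim (use inG in \<open>auto simp: h\<close>)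
    show "AE x in PX. \<forall>t\<in>{0..1}. ((\<lambda>s. \<phi> s x) has_real_derivative \<phi>' t x) (at t)"
      using exists
    proof eventually_elim
      case (elim x)
      then show ?case
        using gateaux2_existsD(1)[of G "\<lambda>u. T u x" g0 h] by (simp add: \<phi>_def \<phi>'_def)
    qed
    show "AE x in PX. \<forall>t\<in>{0..1}. ((\<lambda>s. \<phi>' s x) has_real_derivative \<phi>'' t x) (at t)"
      using exists
    proof eventually_elim
      case (elim x)
      then show ?case
        using gateaux2_existsD(2)[of G "\<lambda>u. T u x" g0 h]
        by (simp add: \<phi>''_def \<phi>'_def[abs_def] \<phi>_def minus_h)
    qed
    show "AE x in PX. \<phi>' 0 x = 0"
      using orth by (simp add: gateaux1_def \<phi>'_def \<phi>_def h)
    show "(\<integral>\<^sup>+x. ennreal ((\<phi>'' t x)\<^sup>2) \<partial>PX) \<le> ?K\<^sup>2" if "t \<in> {0..1}" for t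
      unfolding ennsqrt_le_iff[symmetric] nuisance_err_def \<phi>''_def
      by (rule SUP_upper) (rule segment[OF that])
  qed fact
  moreover have "\<phi> 1 = T g" "\<phi> 0 = T g0"
    by (simp_all add: \<phi>_def[abs_def] shift_def h_def)
  moreover have "(ennreal (1 / 2) * ?K)\<^sup>2 = ?K\<^sup>2 / 4"
  proof -
    have "(ennreal (1 / 2))\<^sup>2 = inverse 4"
      using inverse_ennreal[of 4] by (subst ennreal_power) (auto simp: power_divide inverse_eq_divide)
    then show ?thesis
      by (simp only: power_mult_distrib divide_ennreal_def mult.commute)
  qed
  ultimately show ?thesis
    by (simp add: ennsqrt_le_iff)
qed

section \<open>Product laws of the two subsamples\<close>

lemma (in prob_space) distr_indep_vars_PiM:
  assumes "indep_vars M' X I"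
  shows "distr M (PiM I M') (\<lambda>\<omega>. \<lambda>i\<in>I. X i \<omega>) = PiM I (\<lambda>i. distr M (M' i) (X i))"
proof (cases "I = {}")
  case True
  \<comment> \<open>The empty index set arises for \<open>n = 0\<close>; both sides are then the
    unit mass on the only empty tuple.\<close>
  have "distr M (count_space {\<lambda>_. undefined}) (\<lambda>\<omega> _. undefined) = count_space {\<lambda>_. undefined :: 'c}"
  proof (rule measure_eqI)
    fix A assume "A \<in> sets (distr M (count_space {\<lambda>_. undefined :: 'c}) (\<lambda>\<omega> _. undefined))"
    then have "A = {} \<or> A = {\<lambda>_. undefined :: 'c}"
      by auto
    then show "emeasure (distr M (count_space {\<lambda>_. undefined}) (\<lambda>\<omega> _. undefined)) A
        = emeasure (count_space {\<lambda>_. undefined :: 'c}) A"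
      by (auto simp: emeasure_distr emeasure_space_1)
  qed simp
  with True show ?thesis
    by (simp add: PiM_empty restrict_def)
next
  case False
  then show ?thesis
    using assms by (subst indep_vars_iff_distr_eq_PiM'[symmetric]) (auto simp: indep_vars_def2)
qed

text \<open>Tonelli on the product of the two blocks: a lower bound valid for every frozen first
  block survives averaging over it.\<close>

lemma measure_PiM_ge_of_sections:
  assumes M: "\<And>i. prob_space (M i)" and fin: "finite I" "finite J" and disj: "I \<inter> J = {}"
    and S[measurable]: "S \<in> sets (PiM (I \<union> J) M)"
    and ge: "\<And>z. z \<in> space (PiM I M) \<Longrightarrow> p \<le> measure (PiM J M) {z' \<in> space (PiM J M). merge I J (z, z') \<in> S}"
  shows "p \<le> measure (PiM (I \<union> J) M) S"
proof -
  interpret product_sigma_finite M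
    using M by (simp add: product_sigma_finite_def prob_space_imp_sigma_finite)
  interpret I: prob_space "PiM I M" by (rule prob_space_PiM) (rule M)
  interpret J: prob_space "PiM J M" by (rule prob_space_PiM) (rule M)
  interpret IJ: prob_space "PiM (I \<union> J) M" by (rule prob_space_PiM) (rule M)
  let ?R = "merge I J -` S \<inter> space (PiM I M \<Otimes>\<^sub>M PiM J M)"
  have R: "?R \<in> sets (PiM I M \<Otimes>\<^sub>M PiM J M)"
    by measurable
  have "ennreal p = (\<integral>\<^sup>+z. ennreal p \<partial>PiM I M)"
    by (simp add: I.emeasure_space_1)
  also have "\<dots> \<le> (\<integral>\<^sup>+z. emeasure (PiM J M) (Pair z -` ?R) \<partial>PiM I M)"
  proof (rule nn_integral_mono)
    fix z assume z: "z \<in> space (PiM I M)"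
    then have "Pair z -` ?R = {z' \<in> space (PiM J M). merge I J (z, z') \<in> S}"
      by (auto simp: space_pair_measure)
    then show "ennreal p \<le> emeasure (PiM J M) (Pair z -` ?R)"
      using ge[OF z] by (simp add: J.emeasure_eq_measure ennreal_leI)
  qed
  also have "\<dots> = emeasure (PiM I M \<Otimes>\<^sub>M PiM J M) ?R"
    by (rule J.emeasure_pair_measure_alt[symmetric]) (rule R)
  also have "\<dots> = emeasure (distr (PiM I M \<Otimes>\<^sub>M PiM J M) (PiM (I \<union> J) M) (merge I J)) S"
    by (rule emeasure_distr[symmetric]) measurable
  also have "\<dots> = ennreal (measure (PiM (I \<union> J) M) S)"
    by (simp add: distr_merge[OF disj fin] IJ.emeasure_eq_measure)
  finally show ?thesis
    by simp
qed

text \<open>The second-stage guarantee speaks of samples indexed from 1, whereas the second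
  subsample occupies positions \<open>n + 1\<close> to \<open>2 * n\<close>. Relabelling and then
  applying \<open>T\<close> in each coordinate reconciles the two.\<close>

lemma distr_PiM_shift:
  fixes n :: nat
  assumes P: "prob_space P" and T[measurable]: "T \<in> P \<rightarrow>\<^sub>M N"
  shows "distr (PiM {n + 1..2 * n} (\<lambda>_. P)) (PiM {1..n} (\<lambda>_. distr P N T)) (\<lambda>z. \<lambda>i\<in>{1..n}. T (z (n + i)))
    = PiM {1..n} (\<lambda>_. distr P N T)"
proof -
  interpret P: prob_space P by fact
  let ?Q = "distr P N T"
  let ?r = "\<lambda>z. \<lambda>i\<in>{1..n}. z (n + i)"
  have Q: "prob_space ?Q"
    by (rule P.prob_space_distr) fact
  have T': "T \<in> P \<rightarrow>\<^sub>M ?Q"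
    by simp
  have [measurable]: "?r \<in> PiM {n + 1..2 * n} (\<lambda>_. P) \<rightarrow>\<^sub>M PiM {1..n} (\<lambda>_. P)"
    by (intro measurable_restrict measurable_component_singleton) auto
  have c: "compose {1..n} T \<in> PiM {1..n} (\<lambda>_. P) \<rightarrow>\<^sub>M PiM {1..n} (\<lambda>_. ?Q)"
    unfolding compose_def
    by (intro measurable_restrict measurable_compose[OF measurable_component_singleton[of _ _ "\<lambda>_. P"] T'])
  have "PiM {1..n} (\<lambda>_. ?Q) = distr (PiM {1..n} (\<lambda>_. P)) (PiM {1..n} (\<lambda>_. ?Q)) (compose {1..n} T)"
    using distr_PiM_finite_prob_space'[of "{1..n}" "\<lambda>_. P" "\<lambda>_. ?Q" T] P Q T'
    by (simp add: distr_cong[of P P ?Q N T T])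
  also have "PiM {1..n} (\<lambda>_. P) = distr (PiM {n + 1..2 * n} (\<lambda>_. P)) (PiM {1..n} (\<lambda>_. P)) ?r"
    using distr_PiM_reindex[of "{n + 1..2 * n}" "\<lambda>_. P" "\<lambda>i. n + i" "{1..n}"] P by (auto simp: inj_on_def)
  also have "distr (distr (PiM {n + 1..2 * n} (\<lambda>_. P)) (PiM {1..n} (\<lambda>_. P)) ?r) (PiM {1..n} (\<lambda>_. ?Q)) (compose {1..n} T)
      = distr (PiM {n + 1..2 * n} (\<lambda>_. P)) (PiM {1..n} (\<lambda>_. ?Q)) (compose {1..n} T \<circ> ?r)"
    by (rule distr_distr[OF c]) measurable
  also have "compose {1..n} T \<circ> ?r = (\<lambda>z. \<lambda>i\<in>{1..n}. T (z (n + i)))"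
    by (auto simp: compose_def fun_eq_iff)
  finally show ?thesis ..
qed

lemma first_stage_cong: "(\<And>i. i \<in> {1..n} \<Longrightarrow> z i = z' i) \<Longrightarrow> first_stage A1 n z = first_stage A1 n z'"
  unfolding first_stage_def by (intro arg_cong[where f = A1] map_cong) auto

lemma second_stage_cong:
  assumes "\<And>i. i \<in> {1..2 * n} \<Longrightarrow> z i = z' i"
  shows "second_stage A1 A2 X chi \<theta> n z = second_stage A1 A2 X chi \<theta> n z'"
proof -
  have "first_stage A1 n z = first_stage A1 n z'"
    by (rule first_stage_cong) (use assms in auto)
  then show ?thesis
    unfolding second_stage_def
    by (intro arg_cong[where f = "A2 \<theta>"] map_cong) (use assms in auto)
qed

lemma second_stage_shift:
  "second_stage A1 A2 X chi \<theta> n z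
    = A2 \<theta> (map (\<lambda>i. (X (z (n + i)), chi (first_stage A1 n z) (z (n + i)))) [1..<n + 1])"
proof -
  have "[n + 1..<2 * n + 1] = map (\<lambda>i. i + n) [1..<n + 1]"
    by (rule nth_equalityI) (auto simp del: upt_Suc)
  then show ?thesis
    by (simp add: second_stage_def comp_def add.commute del: upt_Suc)
qed

section \<open>The high-probability bound for the two-stage procedure\<close>

text \<open>\<open>ce\<close> fixes versions of the conditional expectations, since Gateaux
  derivatives in the nuisance are taken at each single \<open>x\<close>. \<open>good_event\<close>
  is assumed because \<open>A2_rate\<close>, applied for each frozen first sample, yields an event
  with no control on its joint measurability in both samples.\<close>

theorem theorem3p5:
  fixes MZ :: "'z measure" and MX :: "'x measure" and MW :: "'w measure"
    and W :: "'z \<Rightarrow> 'w" and \<pi> :: "'w \<Rightarrow> 'x" and X :: "'z \<Rightarrow> 'x"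
    and G :: "('w \<Rightarrow> real ^ 'd) set"
    and l :: "real \<Rightarrow> ('w \<Rightarrow> real ^ 'd) \<Rightarrow> 'z \<Rightarrow> real"
    and chi :: "('w \<Rightarrow> real ^ 'd) \<Rightarrow> 'z \<Rightarrow> real"
    and \<P> :: "'z measure set"
    and g0 :: "'z measure \<Rightarrow> 'w \<Rightarrow> real ^ 'd"
    and ce :: "'z measure \<Rightarrow> ('x \<Rightarrow> real) \<Rightarrow> ('w \<Rightarrow> real ^ 'd) \<Rightarrow> 'x \<Rightarrow> real"
    and \<Theta> :: "('x \<Rightarrow> real) set"
    and A1 :: "'z list \<Rightarrow> 'w \<Rightarrow> real ^ 'd"
    and A2 :: "('x \<Rightarrow> real) \<Rightarrow> ('x \<times> real) list \<Rightarrow> 'x \<Rightarrow> real"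
    and rate1 :: "nat \<Rightarrow> real \<Rightarrow> 'z measure \<Rightarrow> ennreal"
    and rate2 :: "nat \<Rightarrow> real \<Rightarrow> ('x \<times> real) measure \<Rightarrow> ennreal"
    and PZ :: "'z measure" and \<Omega> :: "'o measure" and Z :: "nat \<Rightarrow> 'o \<Rightarrow> 'z"
    and \<theta>0 :: "'x \<Rightarrow> real" and n :: nat and \<delta>1 \<delta>2 :: real
  \<comment> \<open>the setting\<close>
  assumes W: "W \<in> MZ \<rightarrow>\<^sub>M MW" and \<pi>: "\<pi> \<in> MW \<rightarrow>\<^sub>M MX" and X: "X = \<pi> \<circ> W"
    and G_segment: "\<And>f h. f \<in> G \<Longrightarrow> h \<in> G \<Longrightarrow> nuisance_segment MW f h \<subseteq> G"
    and l_diff: "\<And>\<nu> g z. g \<in> G \<Longrightarrow> z \<in> space MZ \<Longrightarrow> (\<lambda>\<nu>. l \<nu> g z) differentiable (at \<nu>)"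
  \<comment> \<open>\<open>\<P>\<close> is the class of data distributions for which the standing assumptions hold\<close>
    and \<P>: "\<P> \<subseteq> space (prob_algebra MZ)"
    and G_L2: "\<And>P. P \<in> \<P> \<Longrightarrow> G \<subseteq> square_integrable_functions (distr P MW W)"
    and g0: "\<And>P. P \<in> \<P> \<Longrightarrow> g0 P \<in> G"
    and dloss_meas: "\<And>P \<theta> g. P \<in> \<P> \<Longrightarrow> \<theta> \<in> borel_measurable MX \<Longrightarrow> g \<in> G \<Longrightarrow>
          dloss l X \<theta> g \<in> borel_measurable P"
    and dloss_int: "\<And>P \<theta> g. P \<in> \<P> \<Longrightarrow> \<theta> \<in> borel_measurable MX \<Longrightarrow> g \<in> G \<Longrightarrow>
          integrable P (\<lambda>z. \<theta> (X z)) \<Longrightarrow> integrable P (dloss l X \<theta> g)"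
    and chi_int: "\<And>P g. P \<in> \<P> \<Longrightarrow> g \<in> G \<Longrightarrow> integrable P (chi g)"
    and chi: "\<And>P \<theta> g. P \<in> \<P> \<Longrightarrow> \<theta> \<in> borel_measurable MX \<Longrightarrow> g \<in> G \<Longrightarrow>
          AE z in P. real_cond_exp P (sigma_rv P X MX) (dloss l X \<theta> g) z =
                     \<theta> (X z) - real_cond_exp P (sigma_rv P X MX) (chi g) z"
  \<comment> \<open>\<open>ce P \<theta> g x\<close> is the conditional expectation of \<open>\<partial>l(\<theta>,g;Z)\<close> given \<open>X = x\<close>\<close>
    and ce: "\<And>P \<theta> g. P \<in> \<P> \<Longrightarrow> \<theta> \<in> borel_measurable MX \<Longrightarrow> g \<in> G \<Longrightarrow>
          cond_exp_version P X MX (dloss l X \<theta> g) (ce P \<theta> g)"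
    and orthogonal: "\<And>P. P \<in> \<P> \<Longrightarrow> universally_orthogonal (distr P MX X) G (ce P) (g0 P)"
    and second_deriv: "\<And>P \<theta>. P \<in> \<P> \<Longrightarrow> \<theta> \<in> borel_measurable MX \<Longrightarrow>
          AE x in distr P MX X. \<forall>f\<in>G. \<forall>g\<in>G.
            gateaux2_exists G (\<lambda>u. ce P \<theta> u x) f (\<lambda>w. g w - g0 P w)"
  \<comment> \<open>the algorithms and their guarantees\<close>
    and \<Theta>: "\<Theta> \<subseteq> borel_measurable MX"
    and A1: "\<And>zs. zs \<in> lists (space MZ) \<Longrightarrow> A1 zs \<in> G"
    and A2: "\<And>\<theta> ps. \<theta> \<in> \<Theta> \<Longrightarrow> ps \<in> lists (space MX \<times> UNIV) \<Longrightarrow> A2 \<theta> ps \<in> \<Theta>"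
    and A1_rate: "\<And>P n \<delta> \<theta>. P \<in> \<P> \<Longrightarrow> 0 < \<delta> \<Longrightarrow> \<delta> < 1 \<Longrightarrow> \<theta> \<in> \<Theta> \<Longrightarrow>
          with_prob_ge (PiM {1..n} (\<lambda>_. P)) (1 - \<delta>)
            (\<lambda>z. nuisance_err (distr P MX X) MW (ce P \<theta>) (first_stage A1 n z) (g0 P)
                   \<le> rate1 n \<delta> P)"
    and A2_rate: "\<And>Q n \<delta> \<theta>. Q \<in> space (prob_algebra (MX \<Otimes>\<^sub>M borel)) \<Longrightarrow> integrable Q snd \<Longrightarrow>
          0 < \<delta> \<Longrightarrow> \<delta> < 1 \<Longrightarrow> \<theta> \<in> \<Theta> \<Longrightarrow>
          with_prob_ge (PiM {1..n} (\<lambda>_. Q)) (1 - \<delta>)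
            (\<lambda>p. classical_cal (A2 \<theta> (map p [1..<n + 1])) Q \<le> rate2 n \<delta> Q)"
  \<comment> \<open>the sample\<close>
    and PZ: "PZ \<in> \<P>"
    and \<Omega>: "prob_space \<Omega>"
    and Z_indep: "prob_space.indep_vars \<Omega> (\<lambda>_. MZ) Z {1..2 * n}"
    and Z_law: "\<And>i. i \<in> {1..2 * n} \<Longrightarrow> distr \<Omega> MZ (Z i) = PZ"
    and \<theta>0: "\<theta>0 \<in> \<Theta>"
    and \<delta>1: "0 < \<delta>1" "\<delta>1 < 1" and \<delta>2: "0 < \<delta>2" "\<delta>2 < 1"
  \<comment> \<open>the good event of the second stage is an event of the sample space\<close>
    and good_event: "{z \<in> space (PiM {1..2 * n} (\<lambda>_. MZ)).
            classical_cal (second_stage A1 A2 X chi \<theta>0 n z)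
                (pseudo_outcome_law PZ MX X chi (first_stage A1 n z))
              \<le> rate2 n \<delta>2 (pseudo_outcome_law PZ MX X chi (first_stage A1 n z))}
          \<in> sets (PiM {1..2 * n} (\<lambda>_. MZ))"
  shows "with_prob_ge \<Omega> (1 - \<delta>1 - \<delta>2)
    (\<lambda>\<omega>. let gh = first_stage A1 n (\<lambda>i. Z i \<omega>);
             \<theta>h = second_stage A1 A2 X chi \<theta>0 n (\<lambda>i. Z i \<omega>)
         in causal_cal PZ l X \<theta>h (g0 PZ)
              \<le> ennreal (1 / 2) * rate1 n \<delta>1 PZ
                + rate2 n \<delta>2 (pseudo_outcome_law PZ MX X chi gh))"
proof -
  interpret prob_space \<Omega> by fact
  let ?PX = "distr PZ MX X" and ?J = "{n + 1..2 * n}"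
  have P: "prob_space PZ" and sets_P: "sets PZ = sets MZ"
    using PZ \<P> by (auto simp: space_prob_algebra)
  interpret P: prob_space PZ by fact
  have space_P: "space PZ = space MZ"
    using sets_P by (rule sets_eq_imp_space_eq)
  have X_MZ: "X \<in> MZ \<rightarrow>\<^sub>M MX"
    unfolding X by (rule measurable_comp[OF W \<pi>])
  then have X_P[measurable]: "X \<in> PZ \<rightarrow>\<^sub>M MX"
    by (simp add: measurable_cong_sets[OF sets_P refl])
  have g0_G: "g0 PZ \<in> G"
    by (rule g0[OF PZ])
  have PX: "sigma_finite_measure ?PX"
    by (intro prob_space_imp_sigma_finite P.prob_space_distr) measurable
  have \<theta>0_meas: "\<theta>0 \<in> borel_measurable MX"
    using \<theta>0 \<Theta> by auto
  \<comment> \<open>A deterministic inequality for all \<open>g\<close> and \<open>\<theta>\<close>,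
    so the random estimates can be substituted pointwise.\<close>
  have cal: "causal_cal PZ l X \<theta> (g0 PZ) \<le> ennreal (1 / 2) * nuisance_err ?PX MW (ce PZ \<theta>0) g (g0 PZ)
      + classical_cal \<theta> (pseudo_outcome_law PZ MX X chi g)" if g: "g \<in> G" and \<theta>: "\<theta> \<in> \<Theta>" for g \<theta>
  proof -
    have "causal_cal PZ l X \<theta> (g0 PZ) \<le> ennsqrt (\<integral>\<^sup>+x. ennreal ((ce PZ \<theta>0 g x - ce PZ \<theta>0 (g0 PZ) x)\<^sup>2) \<partial>?PX)
        + classical_cal \<theta> (pseudo_outcome_law PZ MX X chi g)"
    proof (rule causal_cal_le_classical_cal[OF P X_P _ _ _ _ _ \<theta>0_meas])
      show "\<theta> \<in> borel_measurable MX"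
        using \<theta> \<Theta> by auto
    qed (use g g0_G in \<open>auto intro: dloss_meas[OF PZ] dloss_int[OF PZ] chi_int[OF PZ] chi[OF PZ] ce[OF PZ \<theta>0_meas]\<close>)
    also have "ennsqrt (\<integral>\<^sup>+x. ennreal ((ce PZ \<theta>0 g x - ce PZ \<theta>0 (g0 PZ) x)\<^sup>2) \<partial>?PX)
        \<le> ennreal (1 / 2) * nuisance_err ?PX MW (ce PZ \<theta>0) g (g0 PZ)"
    proof (rule ennsqrt_nn_integral_diff_le_nuisance_err[OF PX g0_G G_segment[OF g g0_G]])
      show "ce PZ \<theta>0 f \<in> borel_measurable ?PX" if "f \<in> G" for f
        using ce[OF PZ \<theta>0_meas that] by (simp add: cond_exp_version_def)
      have "\<theta>0 \<in> borel_measurable ?PX"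
        using \<theta>0_meas by simp
      then have "AE x in ?PX. gateaux1_exists G (\<lambda>f. ce PZ \<theta>0 f x) (g0 PZ) (\<lambda>w. g w - g0 PZ w) \<and>
          gateaux1 (\<lambda>f. ce PZ \<theta>0 f x) (g0 PZ) (\<lambda>w. g w - g0 PZ w) = 0"
        using orthogonal[OF PZ] g unfolding universally_orthogonal_def by blast
      then show "AE x in ?PX. gateaux1 (\<lambda>f. ce PZ \<theta>0 f x) (g0 PZ) (\<lambda>w. g w - g0 PZ w) = 0"
        by eventually_elim simp
      show "AE x in ?PX. \<forall>f\<in>G. gateaux2_exists G (\<lambda>u. ce PZ \<theta>0 u x) f (\<lambda>w. g w - g0 PZ w)"
        using second_deriv[OF PZ \<theta>0_meas] by eventually_elim (use g in blast)
    qed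
    finally show ?thesis
      by (simp add: add_right_mono)
  qed
  have first_G: "first_stage A1 n z \<in> G" if "\<And>i. i \<in> {1..n} \<Longrightarrow> z i \<in> space MZ" for z
    unfolding first_stage_def by (rule A1) (use that in auto)
  have second_\<Theta>: "second_stage A1 A2 X chi \<theta>0 n z \<in> \<Theta>" if "\<And>i. i \<in> {1..2 * n} \<Longrightarrow> z i \<in> space MZ" for z
    unfolding second_stage_def
    by (rule A2[OF \<theta>0]) (use that measurable_space[OF X_MZ] in auto)
  let ?good = "\<lambda>z. classical_cal (second_stage A1 A2 X chi \<theta>0 n z)
      (pseudo_outcome_law PZ MX X chi (first_stage A1 n z))
    \<le> rate2 n \<delta>2 (pseudo_outcome_law PZ MX X chi (first_stage A1 n z))"
  define S where "S = {z \<in> space (PiM {1..2 * n} (\<lambda>_. MZ)). ?good z}"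
  have sets_PiM: "sets (PiM I (\<lambda>_. PZ)) = sets (PiM I (\<lambda>_. MZ))" for I :: "nat set"
    by (rule sets_PiM_cong) (use sets_P in auto)
  have space_PiM_P: "space (PiM I (\<lambda>_. PZ)) = space (PiM I (\<lambda>_. MZ))" for I :: "nat set"
    by (rule sets_eq_imp_space_eq[OF sets_PiM])
  have union: "{1..n} \<union> ?J = {1..2 * n}"
    by auto
  have S: "S \<in> sets (PiM {1..2 * n} (\<lambda>_. MZ))"
    using good_event by (simp add: S_def)
  \<comment> \<open>Once the first sample is frozen, the nuisance estimate and the law of the
    pseudo-outcomes are fixed, and \<open>A2_rate\<close> applies to the second sample.\<close>
  have S_prob: "1 - \<delta>2 \<le> measure (PiM ({1..n} \<union> ?J) (\<lambda>_. PZ)) S"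
  proof (rule measure_PiM_ge_of_sections)
    show S_P: "S \<in> sets (PiM ({1..n} \<union> ?J) (\<lambda>_. PZ))"
      using S by (simp only: union sets_PiM)
    fix z assume z: "z \<in> space (PiM {1..n} (\<lambda>_. PZ))"
    define g where "g = first_stage A1 n z"
    have g: "g \<in> G"
      unfolding g_def by (rule first_G) (use z in \<open>auto simp: space_PiM_P space_PiM\<close>)
    define T where "T z = (X z, chi g z)" for z
    have [measurable]: "chi g \<in> borel_measurable PZ"
      using chi_int[OF PZ g] by auto
    have T[measurable]: "T \<in> PZ \<rightarrow>\<^sub>M MX \<Otimes>\<^sub>M borel"
      unfolding T_def[abs_def] by measurable
    let ?Q = "distr PZ (MX \<Otimes>\<^sub>M borel) T"
    let ?s = "\<lambda>z. \<lambda>i\<in>{1..n}. T (z (n + i))"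
    have Q: "pseudo_outcome_law PZ MX X chi g = ?Q"
      by (simp add: pseudo_outcome_law_def T_def[abs_def])
    have "prob_space ?Q"
      by (rule P.prob_space_distr) measurable
    moreover have "integrable ?Q snd"
      using chi_int[OF PZ g] by (simp add: integrable_distr_eq T_def)
    ultimately obtain E where E: "E \<in> sets (PiM {1..n} (\<lambda>_. ?Q))" "1 - \<delta>2 \<le> measure (PiM {1..n} (\<lambda>_. ?Q)) E"
      and E_good: "\<And>p. p \<in> E \<Longrightarrow> classical_cal (A2 \<theta>0 (map p [1..<n + 1])) ?Q \<le> rate2 n \<delta>2 ?Q"
      using A2_rate[of ?Q \<delta>2 \<theta>0 n] \<delta>2 \<theta>0 by (auto simp: space_prob_algebra with_prob_ge_def simp del: upt_Suc)
    have s[measurable]: "?s \<in> PiM ?J (\<lambda>_. PZ) \<rightarrow>\<^sub>M PiM {1..n} (\<lambda>_. ?Q)"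
    proof (rule measurable_restrict)
      fix i assume "i \<in> {1..n}"
      then have "(\<lambda>z. z (n + i)) \<in> PiM ?J (\<lambda>_. PZ) \<rightarrow>\<^sub>M PZ"
        by (intro measurable_component_singleton) auto
      from measurable_compose[OF this T] show "(\<lambda>z. T (z (n + i))) \<in> PiM ?J (\<lambda>_. PZ) \<rightarrow>\<^sub>M ?Q"
        by simp
    qed
    interpret J: prob_space "PiM ?J (\<lambda>_. PZ)"
      by (rule prob_space_PiM) (rule P)
    have "1 - \<delta>2 \<le> measure (distr (PiM ?J (\<lambda>_. PZ)) (PiM {1..n} (\<lambda>_. ?Q)) ?s) E"
      using E(2) by (simp only: distr_PiM_shift[OF P T])
    also have "\<dots> = measure (PiM ?J (\<lambda>_. PZ)) (?s -` E \<inter> space (PiM ?J (\<lambda>_. PZ)))"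
      by (rule measure_distr[OF s E(1)])
    also have "\<dots> \<le> measure (PiM ?J (\<lambda>_. PZ)) {z' \<in> space (PiM ?J (\<lambda>_. PZ)). merge {1..n} ?J (z, z') \<in> S}"
    proof (rule J.finite_measure_mono)
      have "(\<lambda>z'. merge {1..n} ?J (z, z')) \<in> PiM ?J (\<lambda>_. PZ) \<rightarrow>\<^sub>M PiM ({1..n} \<union> ?J) (\<lambda>_. PZ)"
        using z by measurable
      from measurable_sets[OF this S_P]
      show "{z' \<in> space (PiM ?J (\<lambda>_. PZ)). merge {1..n} ?J (z, z') \<in> S} \<in> sets (PiM ?J (\<lambda>_. PZ))"
        by (simp add: vimage_def Int_def conj_commute)
      show "?s -` E \<inter> space (PiM ?J (\<lambda>_. PZ)) \<subseteq> {z' \<in> space (PiM ?J (\<lambda>_. PZ)). merge {1..n} ?J (z, z') \<in> S}"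
      proof safe
        fix z' assume z': "z' \<in> space (PiM ?J (\<lambda>_. PZ))" and sE: "?s z' \<in> E"
        let ?m = "merge {1..n} ?J (z, z')"
        have first: "first_stage A1 n ?m = g"
          unfolding g_def by (rule first_stage_cong) (simp add: merge_def)
        have "second_stage A1 A2 X chi \<theta>0 n ?m = A2 \<theta>0 (map (?s z') [1..<n + 1])"
          unfolding second_stage_shift first
          by (intro arg_cong[where f = "A2 \<theta>0"] map_cong) (auto simp: T_def merge_def)
        with E_good[OF sE] have "?good ?m"
          by (simp only: first Q)
        moreover have "?m \<in> space (PiM {1..2 * n} (\<lambda>_. MZ))"
          using z z' by (subst union[symmetric]) (auto simp: space_PiM_P space_PiM merge_def PiE_iff extensional_def)
        ultimately show "?m \<in> S"
          by (simp add: S_def)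
      qed
    qed
    finally show "1 - \<delta>2 \<le> measure (PiM ?J (\<lambda>_. PZ)) {z' \<in> space (PiM ?J (\<lambda>_. PZ)). merge {1..n} ?J (z, z') \<in> S}" .
  qed (use P in auto)
  \<comment> \<open>The guarantee is taken at \<open>\<theta>0\<close>, which is fixed before the
    data are seen, as \<open>A1_rate\<close> holds for each fixed predictor separately.\<close>
  obtain E where E: "E \<in> sets (PiM {1..n} (\<lambda>_. PZ))" "1 - \<delta>1 \<le> measure (PiM {1..n} (\<lambda>_. PZ)) E"
    and E_good: "\<And>z. z \<in> E \<Longrightarrow> nuisance_err ?PX MW (ce PZ \<theta>0) (first_stage A1 n z) (g0 PZ) \<le> rate1 n \<delta>1 PZ"
    using A1_rate[OF PZ \<delta>1 \<theta>0, of n] by (auto simp: with_prob_ge_def)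
  have Z: "Z i \<in> \<Omega> \<rightarrow>\<^sub>M MZ" if "i \<in> {1..2 * n}" for i
    using Z_indep that by (auto simp: indep_vars_def2)
  let ?V = "\<lambda>I \<omega>. \<lambda>i\<in>I. Z i \<omega>"
  have V: "?V I \<in> \<Omega> \<rightarrow>\<^sub>M PiM I (\<lambda>_. MZ)" if "I \<subseteq> {1..2 * n}" for I
    by (rule measurable_restrict) (use Z that in auto)
  have V_law: "distr \<Omega> (PiM I (\<lambda>_. MZ)) (?V I) = PiM I (\<lambda>_. PZ)" if I: "I \<subseteq> {1..2 * n}" for I
  proof -
    have "distr \<Omega> (PiM I (\<lambda>_. MZ)) (?V I) = PiM I (\<lambda>i. distr \<Omega> MZ (Z i))"
      by (rule distr_indep_vars_PiM[OF indep_vars_subset[OF Z_indep I]])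
    also have "\<dots> = PiM I (\<lambda>_. PZ)"
      by (rule PiM_cong) (use Z_law I in auto)
    finally show ?thesis .
  qed
  have V_prob: "measure \<Omega> (?V I -` B \<inter> space \<Omega>) = measure (PiM I (\<lambda>_. PZ)) B"
    if "I \<subseteq> {1..2 * n}" "B \<in> sets (PiM I (\<lambda>_. MZ))" for I B
    using measure_distr[OF V that(2)] that(1) by (simp add: V_law)
  let ?E = "?V {1..n} -` E \<inter> space \<Omega>" and ?S = "?V {1..2 * n} -` S \<inter> space \<Omega>"
  have n2: "{1..n} \<subseteq> {1..2 * n}"
    by auto
  have E_MZ: "E \<in> sets (PiM {1..n} (\<lambda>_. MZ))"
    using E(1) by (simp only: sets_PiM)
  have ev: "?E \<in> events" "?S \<in> events"
    using measurable_sets[OF V[OF n2] E_MZ] measurable_sets[OF V[OF order_refl] S] by auto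
  show ?thesis
    unfolding with_prob_ge_def Let_def
  proof (intro bexI conjI ballI)
    show "?E \<inter> ?S \<in> events"
      using ev by (rule sets.Int)
    have "1 - \<delta>1 \<le> prob ?E" "1 - \<delta>2 \<le> prob ?S"
      using E(2) S_prob unfolding V_prob[OF n2 E_MZ] V_prob[OF order_refl S] union .
    \<comment> \<open>A union bound: \<open>?S\<close> also depends on the first sample, so
      \<open>?E\<close> and \<open>?S\<close> need not be independent.\<close>
    moreover have "prob ?E + prob ?S - prob (?E \<inter> ?S) \<le> 1"
      using finite_measure_Union'[OF ev] finite_measure_Diff'[OF ev(2,1)] prob_le_1[of "?E \<union> ?S"]
      by (simp add: Int_commute)
    ultimately show "1 - \<delta>1 - \<delta>2 \<le> prob (?E \<inter> ?S)"
      by linarith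
  next
    fix \<omega> assume \<omega>: "\<omega> \<in> ?E \<inter> ?S"
    let ?z = "\<lambda>i. Z i \<omega>"
    let ?g = "first_stage A1 n ?z" and ?\<theta> = "second_stage A1 A2 X chi \<theta>0 n ?z"
    have z: "?z i \<in> space MZ" if "i \<in> {1..2 * n}" for i
      using measurable_space[OF Z[OF that]] \<omega> by auto
    have "?g = first_stage A1 n (?V {1..n} \<omega>)" "?g = first_stage A1 n (?V {1..2 * n} \<omega>)"
      "?\<theta> = second_stage A1 A2 X chi \<theta>0 n (?V {1..2 * n} \<omega>)"
      by (auto intro!: first_stage_cong second_stage_cong)
    moreover have "?V {1..n} \<omega> \<in> E" "?V {1..2 * n} \<omega> \<in> S"
      using \<omega> by auto
    ultimately have "nuisance_err ?PX MW (ce PZ \<theta>0) ?g (g0 PZ) \<le> rate1 n \<delta>1 PZ" and "?good ?z"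
      using E_good[of "?V {1..n} \<omega>"] by (auto simp: S_def)
    then have "ennreal (1 / 2) * nuisance_err ?PX MW (ce PZ \<theta>0) ?g (g0 PZ)
        + classical_cal ?\<theta> (pseudo_outcome_law PZ MX X chi ?g)
      \<le> ennreal (1 / 2) * rate1 n \<delta>1 PZ + rate2 n \<delta>2 (pseudo_outcome_law PZ MX X chi ?g)"
      by (intro add_mono mult_left_mono) auto
    moreover have "?g \<in> G" "?\<theta> \<in> \<Theta>"
      using z by (auto intro: first_G second_\<Theta>)
    ultimately show "causal_cal PZ l X ?\<theta> (g0 PZ)
      \<le> ennreal (1 / 2) * rate1 n \<delta>1 PZ + rate2 n \<delta>2 (pseudo_outcome_law PZ MX X chi ?g)"
      using cal order_trans by blast
  qed
qed

end
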